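(* Let $T=1$ or $T=2$, and let $0<p<1$ be fixed, $q=1-p$. Let $\mu(N)$ be the length of the longest $T$-contaminated run of heads during $N$ tosses of a coin with probability of heads $p$. Let $$ \begin{aligned} m(N)=\;&\log(qN)+T\log(\log(qN))\\ &+T^2\frac{\log(\log(qN))}{c\log(qN)}-\frac{T}{c\,q_0\log(qN)}-\frac{T^3}{2c}\left(\frac{\log(\log(qN))}{\log(qN)}\right)^2\\ &+T^2\frac{\log(\log(qN))}{c\,q_0(\log(qN))^2}+T^3\frac{\log(\log(qN))}{(c\log(qN))^2}\\ &+\left(T\log\left(\frac{q}{p}\right)-\log(T!)\right)\left(1+\frac{T}{c\log(qN)}-T^2\frac{\log(\log(qN))}{c(\log(qN))^2}\right), \end{aligned} $$ where $\log$ denotes the logarithm of base $1/p$, $c=\ln(1/p)$ with $\ln$ the natural logarithm, and $q_0=\frac{2q}{2+Tq-q}$. Let $[m(N)]$ denote the integer part of $m(N)$ and $\{m(N)\}=m(N)-[m(N)]$ its fractional part. Then, for any integer $k$, $$ P\big(\mu(N)-[m(N)]<k\big)=\exp\left(-p^{\,(k-\{m(N)\})\left(1-\frac{T}{c\log(qN)}+T^2\frac{\log(\log(qN))}{c(\log(qN))^2}\right)}\right)\left(1+O\left(\frac{1}{(\log N)^2}\right)\right) $$ as $N\to\infty$.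
   Context: Let $X_1,X_2,\dots,X_N$ be independent identically distributed random variables with $P(X_i=1)=p$ (heads) and $P(X_i=0)=q=1-p$ (tails). A $T$-contaminated run of heads of length $m$ is a block of consecutive tosses $X_n,X_{n+1},\dots,X_{n+m-1}$ (with $1\le n$ and $n+m-1\le N$) containing precisely $T$ zeros, all other values being ones. $\mu(N)$ is the largest length $m$ of such a block among the $N$ tosses (with the convention $\mu(N)=0$ if there is no such block). The logarithm $\log$ is everywhere to base $1/p$. The notation $f(N)=O(h(N))$ means that $f(N)/h(N)$ is bounded as $N\to\infty$ (with $p$, $T$ and $k$ fixed). *)

theory Defs
  imports "HOL-Probability.Probability"
begin

text \<open>A toss sequence is a function \<open>x :: nat \<Rightarrow> real\<close>, of which only the values
  \<open>x 1, \<dots>, x N\<close> matter; \<open>1\<close> stands for heads, \<open>0\<close> for tails.\<close>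

definition contaminated_run :: "nat \<Rightarrow> nat \<Rightarrow> (nat \<Rightarrow> real) \<Rightarrow> nat \<Rightarrow> nat \<Rightarrow> bool" where
  "contaminated_run T N x n m \<longleftrightarrow>
     1 \<le> n \<and> n + m - 1 \<le> N \<and>
     card {i \<in> {n..<n + m}. x i = 0} = T \<and>
     (\<forall>i \<in> {n..<n + m}. x i \<noteq> 0 \<longrightarrow> x i = 1)"

text \<open>Inserting \<open>0\<close> implements the convention for sequences without such a block.\<close>

definition longest_run :: "nat \<Rightarrow> nat \<Rightarrow> (nat \<Rightarrow> real) \<Rightarrow> nat" where
  "longest_run T N x = Max (insert 0 {m. \<exists>n. contaminated_run T N x n m})"

text \<open>The iterated logarithm is meaningful only once \<open>(1 - p) * N > 1\<close>, so the values for
  smaller \<open>N\<close> are irrelevant.\<close>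

definition run_centering :: "real \<Rightarrow> nat \<Rightarrow> nat \<Rightarrow> real" where
  "run_centering p T N =
    (let q = 1 - p;
         c = ln (1 / p);
         q0 = 2 * q / (2 + real T * q - q);
         L = log (1 / p) (q * real N);
         LL = log (1 / p) L
     in L + real T * LL
        + (real T)^2 * (LL / (c * L)) - real T / (c * q0 * L)
        - (real T)^3 / (2 * c) * (LL / L)^2
        + (real T)^2 * (LL / (c * q0 * L^2)) + (real T)^3 * (LL / (c * L)^2)
        + (real T * log (1 / p) (q / p) - log (1 / p) (fact T))
          * (1 + real T / (c * L) - (real T)^2 * (LL / (c * L^2))))"

definition run_main_term :: "real \<Rightarrow> nat \<Rightarrow> int \<Rightarrow> nat \<Rightarrow> real" where
  "run_main_term p T k N =
    (let q = 1 - p;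
         c = ln (1 / p);
         L = log (1 / p) (q * real N);
         LL = log (1 / p) L
     in exp (- (p powr ((real_of_int k - frac (run_centering p T N))
          * (1 - real T / (c * L) + (real T)^2 * (LL / (c * L^2)))))))"

end

theory Submission
  imports Defs "HOL-Real_Asymp.Real_Asymp"
begin

text \<open>Up to an event of probability \<open>O(1/N)\<close>, \<open>\<mu>(N) < w\<close> means that every window of \<open>w\<close> tosses
  contains more than \<open>T\<close> tails. Let \<open>f(n)\<close> be the probability of this for \<open>n\<close> tosses, \<open>a\<close> the
  probability that a given window has at most \<open>T\<close> tails, and \<open>\<beta>\<close> the probability that it has while
  the \<open>w\<close> windows before it have not. Independence of disjoint blocks gives
  \<open>f(n) - f(n+1) = \<beta> f(n) + O(w a\<^sup>2)\<close>, hence \<open>f(N) = exp(-N \<beta>) + O(w a + N w a\<^sup>2)\<close>, where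
  \<open>N a = O(1)\<close> for the relevant \<open>w\<close>. Counting configurations yields
  \<open>\<beta> = q\<^bsup>T+1\<^esup> p\<^bsup>w-T\<^esup> (w\<^sup>T / T!) (1 - T/(q\<^sub>0 w) + O(1/w\<^sup>2))\<close>. The centering \<open>m(N)\<close> is an approximate
  solution of \<open>N \<beta> = 1\<close> in \<open>w\<close>; shifting \<open>w\<close> from \<open>m(N)\<close> by the bounded amount \<open>k - {m(N)}\<close> turns
  \<open>N \<beta>\<close> into the power of \<open>p\<close> in the main term, up to \<open>O(1/(log N)\<^sup>2)\<close>.\<close>

section \<open>Windows in random toss lists\<close>

text \<open>Overlapping windows with few tails come in clumps, so \<open>N * a\<close> overcounts.
  Only the first window of a clump is nearly independent of the past; asymptotically \<beta> is
  \<open>q * a\<close>, as the toss next to the newest window must be a tail.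

  Precision is an issue for \<beta> alone: the window errors have order \<open>log N / N\<close>,
  whereas a relative error \<open>1 / w^2\<close> in \<beta> just matches the claim. Its term in
  \<open>1 / w\<close> has two sources: \<open>w choose T\<close> loses
  \<open>T * (T - 1) / 2\<close>, and tails near the newest end of the window, which the preceding
  block cannot always outpace, lose \<open>T / q\<close>. Their sum is \<open>T / q\<^sub>0\<close>.
  The restriction on \<open>T\<close> enters here, where the configurations are summed explicitly.

  The factor in the exponent of the main term is a derivative: moving \<open>w\<close> from
  \<open>m\<close> by \<theta> changes the logarithm of \<open>N \<beta>\<close> by about
  \<open>- c * \<theta> + T * \<theta> / m\<close>, and \<open>1 / m\<close> is then expanded in
  \<open>log (q N)\<close>. Since \<theta> is bounded, the main term stays away from 0, so that
  absolute errors suffice; since \<theta> varies with \<open>N\<close>, the estimates are uniform in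
  it.\<close>

lemma abs_exp_minus_one_minus:
  fixes x :: real assumes "0 \<le> x" shows "\<bar>exp (- x) - (1 - x)\<bar> \<le> x^2"
proof -
  have "exp (- x) \<le> 1 / (1 + x)"
    using assms exp_ge_add_one_self[of x] by (simp add: exp_minus field_simps)
  \<comment> \<open>The product is \<open>1 + x^3\<close>.\<close>
  also have "1 \<le> (1 + x) * (1 - x + x^2)" using assms by (simp add: algebra_simps power2_eq_square)
  then have "1 / (1 + x) \<le> 1 - x + x^2" using assms by (simp add: field_simps)
  finally show ?thesis using exp_ge_add_one_self[of "- x"] by linarith
qed

text \<open>\<open>True\<close> stands for tails, so \<open>q\<close> is the probability of tails.\<close>

definition tosses :: "real \<Rightarrow> nat \<Rightarrow> bool list pmf" where
  "tosses q n = replicate_pmf n (bernoulli_pmf q)"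

text \<open>Asking for more than \<open>T\<close> tails, instead of a number different from
  \<open>T\<close>, lets the single width \<open>w\<close> account for all longer runs;
  \<open>longest_run_less_iff\<close> returns to exactly \<open>T\<close> zeros. Lists shorter than
  \<open>w\<close> qualify vacuously, so for \<open>w \<ge> 1\<close> \<open>avoid_prob\<close>
  starts at 1.\<close>

definition avoids :: "nat \<Rightarrow> nat \<Rightarrow> bool list \<Rightarrow> bool" where
  "avoids T w xs \<longleftrightarrow> (\<forall>i. i + w \<le> length xs \<longrightarrow> T < count_list (take w (drop i xs)) True)"

definition avoid_prob :: "real \<Rightarrow> nat \<Rightarrow> nat \<Rightarrow> nat \<Rightarrow> real" where
  "avoid_prob q T w n = measure_pmf.prob (tosses q n) {xs. avoids T w xs}"

text \<open>The toss sequence grows at its head: this is the probability that the newest window is the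
  first one with at most \<open>T\<close> tails.\<close>

definition first_prob :: "real \<Rightarrow> nat \<Rightarrow> nat \<Rightarrow> nat \<Rightarrow> real" where
  "first_prob q T w n =
     measure_pmf.prob (tosses q (Suc n)) {xs. avoids T w (tl xs) \<and> \<not> avoids T w xs}"

definition few_prob :: "real \<Rightarrow> nat \<Rightarrow> nat \<Rightarrow> real" where
  "few_prob q T w = measure_pmf.prob (tosses q w) {xs. count_list xs True \<le> T}"

lemma length_tosses: "xs \<in> set_pmf (tosses q n) \<Longrightarrow> length xs = n"
  by (auto simp: tosses_def set_replicate_pmf)

lemma prob_tosses_mono:
  assumes "\<And>xs. length xs = n \<Longrightarrow> P xs \<Longrightarrow> Q xs"
  shows "measure_pmf.prob (tosses q n) {xs. P xs} \<le> measure_pmf.prob (tosses q n) {xs. Q xs}"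
  using assms by (intro measure_pmf.finite_measure_mono_AE)
    (auto simp: AE_measure_pmf_iff dest: length_tosses)

lemma prob_tosses_cong:
  assumes "\<And>xs. length xs = n \<Longrightarrow> P xs \<longleftrightarrow> Q xs"
  shows "measure_pmf.prob (tosses q n) {xs. P xs} = measure_pmf.prob (tosses q n) {xs. Q xs}"
  using prob_tosses_mono[of n P Q q] prob_tosses_mono[of n Q P q] assms by force

text \<open>This is the form in which independence of disjoint blocks enters all window
  estimates.\<close>

lemma prob_tosses_split:
  "measure_pmf.prob (tosses q (m + n)) {xs. P (take m xs) \<and> Q (drop m xs)} =
     measure_pmf.prob (tosses q m) {xs. P xs} * measure_pmf.prob (tosses q n) {xs. Q xs}"
proof -
  have "tosses q (m + n) = map_pmf (\<lambda>(xs, ys). xs @ ys) (pair_pmf (tosses q m) (tosses q n))"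
    unfolding tosses_def replicate_pmf_distrib
    by (simp add: map_pmf_def pair_pmf_def bind_assoc_pmf bind_return_pmf)
  then have "measure_pmf.prob (tosses q (m + n)) {xs. P (take m xs) \<and> Q (drop m xs)} =
      measure_pmf.prob (pair_pmf (tosses q m) (tosses q n))
        {z. P (take m (fst z @ snd z)) \<and> Q (drop m (fst z @ snd z))}"
    by (simp add: vimage_def case_prod_beta)
  also have "\<dots> = measure_pmf.prob (pair_pmf (tosses q m) (tosses q n)) ({xs. P xs} \<times> {xs. Q xs})"
    by (intro measure_pmf.finite_measure_eq_AE) (auto simp: AE_measure_pmf_iff dest!: length_tosses)
  also have "\<dots> = measure_pmf.prob (tosses q m) {xs. P xs} * measure_pmf.prob (tosses q n) {xs. Q xs}"
    by (intro measure_pmf_prob_product) auto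
  finally show ?thesis .
qed

lemma prob_tosses_take:
  "measure_pmf.prob (tosses q (m + n)) {xs. P (take m xs)} = measure_pmf.prob (tosses q m) {xs. P xs}"
  using prob_tosses_split[of q m n P "\<lambda>_. True"] by simp

lemma prob_tosses_drop:
  "measure_pmf.prob (tosses q (m + n)) {xs. P (drop m xs)} = measure_pmf.prob (tosses q n) {xs. P xs}"
  using prob_tosses_split[of q m n "\<lambda>_. True" P] by simp

lemma avoids_Cons:
  "avoids T w (x # xs) \<longleftrightarrow>
     avoids T w xs \<and> (w \<le> Suc (length xs) \<longrightarrow> T < count_list (take w (x # xs)) True)"
proof -
  have "(\<forall>i. Q i) \<longleftrightarrow> Q 0 \<and> (\<forall>i. Q (Suc i))" for Q :: "nat \<Rightarrow> bool"
    by (metis not0_implies_Suc)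
  from this[of "\<lambda>i. i + w \<le> length (x # xs) \<longrightarrow> T < count_list (take w (drop i (x # xs))) True"]
  show ?thesis unfolding avoids_def by auto
qed

lemma avoids_drop:
  assumes "avoids T w xs" shows "avoids T w (drop n xs)"
proof (cases "n \<le> length xs")
  case True
  show ?thesis unfolding avoids_def
  proof (intro allI impI)
    fix i assume "i + w \<le> length (drop n xs)"
    with True have "(i + n) + w \<le> length xs" by simp
    with assms show "T < count_list (take w (drop i (drop n xs))) True"
      unfolding avoids_def drop_drop by blast
  qed
next
  case False
  \<comment> \<open>An empty window has no tails, so \<open>avoids\<close> fails for width 0; hence
    the empty list left by \<open>drop\<close> is too short to contain a window.\<close>
  have "w \<noteq> 0" using assms unfolding avoids_def by (metis add_0 le0 less_nat_zero_code list.size(3) count_list.simps(1) take_0)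
  then show ?thesis using False by (simp add: avoids_def)
qed

lemma avoids_take:
  assumes "avoids T w xs" shows "avoids T w (take n xs)"
  unfolding avoids_def
proof (intro allI impI)
  fix i assume i: "i + w \<le> length (take n xs)"
  then have "take w (drop i (take n xs)) = take w (drop i xs)"
    by (simp add: drop_take min_absorb1 le_diff_conv2)
  with i assms show "T < count_list (take w (drop i (take n xs))) True"
    by (simp add: avoids_def)
qed

lemma few_prob_nonneg: "0 \<le> few_prob q T w"
  and first_prob_nonneg: "0 \<le> first_prob q T w n"
  and avoid_prob_nonneg: "0 \<le> avoid_prob q T w n"
  and avoid_prob_le_1: "avoid_prob q T w n \<le> 1"
  by (simp_all add: few_prob_def first_prob_def avoid_prob_def)

lemma few_prob_le_1: "few_prob q T w \<le> 1"
  by (simp add: few_prob_def)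

section \<open>Recursion for the avoidance probability\<close>

lemma avoid_prob_Suc: "avoid_prob q T w (Suc n) = avoid_prob q T w n - first_prob q T w n"
proof -
  have "avoid_prob q T w n = measure_pmf.prob (tosses q (1 + n)) {xs. avoids T w (drop 1 xs)}"
    unfolding avoid_prob_def by (rule prob_tosses_drop[symmetric])
  also have "\<dots> = measure_pmf.prob (tosses q (Suc n)) ({xs. avoids T w xs} \<union>
      {xs. avoids T w (tl xs) \<and> \<not> avoids T w xs})"
    using avoids_drop[of T w _ 1]
    by (intro arg_cong2[of _ _ _ _ measure]) (auto simp: drop_Suc)
  also have "\<dots> = avoid_prob q T w (Suc n) + first_prob q T w n"
    unfolding avoid_prob_def first_prob_def
    by (intro measure_pmf.finite_measure_Union) auto
  finally show ?thesis by simp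
qed

lemma first_prob_le_few: "first_prob q T w n \<le> few_prob q T w"
proof (cases "w \<le> Suc n")
  case True
  then obtain r where r: "Suc n = w + r" by (auto simp: le_iff_add)
  have "first_prob q T w n \<le> measure_pmf.prob (tosses q (Suc n)) {xs. count_list (take w xs) True \<le> T}"
    unfolding first_prob_def
  proof (rule prob_tosses_mono)
    fix xs :: "bool list"
    assume "length xs = Suc n" "avoids T w (tl xs) \<and> \<not> avoids T w xs"
    then show "count_list (take w xs) True \<le> T"
      by (cases xs) (auto simp: avoids_Cons)
  qed
  also have "\<dots> = few_prob q T w"
    unfolding r few_prob_def by (rule prob_tosses_take)
  finally show ?thesis .
next
  case False
  have "first_prob q T w n \<le> measure_pmf.prob (tosses q (Suc n)) {xs. False}"
    unfolding first_prob_def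
  proof (rule prob_tosses_mono)
    fix xs :: "bool list"
    assume "length xs = Suc n" "avoids T w (tl xs) \<and> \<not> avoids T w xs"
    with False show False by (auto simp: avoids_def)
  qed
  then show ?thesis using few_prob_nonneg[of q T w] by simp
qed

lemma avoid_prob_antimono: "m \<le> n \<Longrightarrow> avoid_prob q T w n \<le> avoid_prob q T w m"
  by (rule lift_Suc_antimono_le[of "avoid_prob q T w"])
    (simp_all add: avoid_prob_Suc first_prob_nonneg)

lemma avoid_prob_add_ge: "avoid_prob q T w (m + n) \<ge> avoid_prob q T w m - real n * few_prob q T w"
proof (induction n)
  case (Suc n)
  then show ?case
    using first_prob_le_few[of q T w "m + n"] by (simp add: avoid_prob_Suc algebra_simps)
qed auto

lemma avoid_prob_ge:
  assumes "w \<ge> 1" shows "1 - avoid_prob q T w n \<le> real n * few_prob q T w"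
proof -
  have "avoid_prob q T w 0 = 1"
    using assms by (simp add: avoid_prob_def tosses_def avoids_def)
  then show ?thesis using avoid_prob_add_ge[of q T w 0 n] by simp
qed

text \<open>Ignoring the windows that straddle position \<open>2 * w\<close> leaves one condition on
  the first \<open>2 * w\<close> tosses and one on the other \<open>r\<close>, and these are
  independent.\<close>

lemma first_prob_upper:
  assumes "w \<ge> 1" "Suc n = 2 * w + r"
  shows "first_prob q T w n \<le> first_prob q T w (2 * w - 1) * avoid_prob q T w r"
proof -
  have "first_prob q T w n \<le> measure_pmf.prob (tosses q (Suc n))
     {xs. (avoids T w (tl (take (2 * w) xs)) \<and> \<not> avoids T w (take (2 * w) xs)) \<and>
          avoids T w (drop (2 * w) xs)}"
    unfolding first_prob_def
  proof (rule prob_tosses_mono, intro conjI)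
    fix xs :: "bool list"
    assume len: "length xs = Suc n" and A: "avoids T w (tl xs) \<and> \<not> avoids T w xs"
    obtain y ys where xs: "xs = y # ys" using len by (cases xs) auto
    obtain v where v: "2 * w = Suc v" using assms by (cases "2 * w") auto
    have "tl (take (2 * w) xs) = take v (tl xs)" by (simp add: xs v)
    then show "avoids T w (tl (take (2 * w) xs))" using A avoids_take by metis
    show "avoids T w (drop (2 * w) xs)"
      using A avoids_drop[of T w "tl xs" v] by (simp add: xs v)
    have "\<not> T < count_list (take w xs) True" using A by (simp add: xs avoids_Cons)
    moreover have "take w (drop 0 (take (2 * w) xs)) = take w xs" by (simp add: min_def)
    ultimately show "\<not> avoids T w (take (2 * w) xs)"
      unfolding avoids_def using len assms by (metis add_0 add_leD1 le_add1 length_take min.absorb2 mult_2)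
  qed
  also have "\<dots> = measure_pmf.prob (tosses q (2 * w)) {xs. avoids T w (tl xs) \<and> \<not> avoids T w xs} *
      avoid_prob q T w r"
    unfolding assms(2) avoid_prob_def by (rule prob_tosses_split)
  also have "2 * w = Suc (2 * w - 1)" using assms by simp
  finally show ?thesis by (simp add: first_prob_def)
qed

text \<open>The loss comes from windows with at most \<open>T\<close> tails that straddle position \<open>2 * w\<close>. They lie
  beyond the newest window, hence are independent of it.\<close>

lemma first_prob_lower:
  assumes "w \<ge> 1" "Suc n = 2 * w + r" "r \<ge> w"
  shows "first_prob q T w (2 * w - 1) * avoid_prob q T w r
           \<le> first_prob q T w n + 2 * real w * (few_prob q T w)^2"
proof -
  let ?B = "\<lambda>xs. (avoids T w (tl (take (2 * w) xs)) \<and> \<not> avoids T w (take (2 * w) xs)) \<and>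
          avoids T w (drop (2 * w) xs)"
  let ?D = "\<lambda>xs. count_list (take w xs) True \<le> T \<and> \<not> avoids T w (take (2 * w) (drop w xs))"
  obtain s where s: "Suc n = w + (2 * w + s)" using assms by (auto simp: le_iff_add)
  have e: "2 * w = Suc (2 * w - 1)" using assms by simp
  have "first_prob q T w (2 * w - 1) * avoid_prob q T w r
       = measure_pmf.prob (tosses q (2 * w)) {xs. avoids T w (tl xs) \<and> \<not> avoids T w xs} *
          avoid_prob q T w r" unfolding first_prob_def using e by simp
  also have "\<dots> = measure_pmf.prob (tosses q (Suc n)) {xs. ?B xs}"
    unfolding assms(2) avoid_prob_def by (rule prob_tosses_split[symmetric])
  also have "\<dots> \<le> measure_pmf.prob (tosses q (Suc n))
      {xs. (avoids T w (tl xs) \<and> \<not> avoids T w xs) \<or> ?D xs}"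
  proof (rule prob_tosses_mono)
    fix xs :: "bool list"
    assume len: "length xs = Suc n" and B: "?B xs"
    obtain y ys where xs: "xs = y # ys" using len by (cases xs) auto
    obtain v where v: "2 * w = Suc v" using assms by (cases "2 * w") auto
    have na: "\<not> avoids T w xs" using B avoids_take by blast
    have tl: "tl (take (2 * w) xs) = take v ys" by (simp add: xs v)
    have len2: "length ys = n" using len by (simp add: xs)
    show "(avoids T w (tl xs) \<and> \<not> avoids T w xs) \<or> ?D xs"
    proof (cases "avoids T w (tl xs)")
      case True then show ?thesis using na by simp
    next
      case False
      have few: "count_list (take w xs) True \<le> T"
      proof -
        have "take (2 * w) xs = y # take v ys" by (simp add: xs v)
        then have "\<not> T < count_list (take w (y # take v ys)) True"
          using B tl by (auto simp: avoids_Cons)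
        moreover have "take w (y # take v ys) = take w xs"
          using v assms(1) unfolding xs by (cases w) (auto simp: min_def)
        ultimately show ?thesis by simp
      qed
      from False obtain i where i: "i + w \<le> length ys" "\<not> T < count_list (take w (drop i ys)) True"
        by (auto simp: avoids_def xs)
      have "\<not> avoids T w (take (2 * w) (drop w xs))"
      proof -
        \<comment> \<open>The window found at \<open>i\<close> lies neither within the first
          \<open>2 * w\<close> tosses nor entirely beyond them, as both parts avoid. It therefore
          straddles the cut and sits inside the \<open>2 * w\<close> tosses that follow the newest
          window.\<close>
        have 1: "\<not> i + w \<le> v"
        proof
          assume a: "i + w \<le> v"
          then have "take w (drop i (take v ys)) = take w (drop i ys)"
            by (simp add: drop_take min_absorb1)
          moreover have "i + w \<le> length (take v ys)" using a i by simp
          moreover have "avoids T w (take v ys)" using B tl by simp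
          ultimately show False using i unfolding avoids_def by metis
        qed
        have 2: "i < v"
        proof (rule ccontr)
          assume a: "\<not> i < v"
          have "avoids T w (drop v ys)" using B by (simp add: xs v)
          moreover have "take w (drop (i - v) (drop v ys)) = take w (drop i ys)" using a by simp
          moreover have "i - v + w \<le> length (drop v ys)" using a i by simp
          ultimately show False using i unfolding avoids_def by metis
        qed
        \<comment> \<open>\<open>i\<close> counts from the second toss of \<open>xs\<close>;
          \<open>j\<close> is the same position counted after the first \<open>w\<close>
          tosses.\<close>
        define j where "j = Suc i - w"
        have j: "j + w = Suc i" using 1 v assms(1) unfolding j_def by linarith
        have jw: "j + w \<le> 2 * w" using j 2 v by simp
        have "take w (drop j (take (2 * w) (drop w xs))) = take w (drop i ys)"
          using jw j by (simp add: drop_take min_absorb1 xs)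
        moreover have "j + w \<le> length (take (2 * w) (drop w xs))"
          using jw j i len len2 by simp
        ultimately show ?thesis using i unfolding avoids_def by metis
      qed
      with few show ?thesis by simp
    qed
  qed
  also have "{xs. (avoids T w (tl xs) \<and> \<not> avoids T w xs) \<or> ?D xs} =
      {xs. avoids T w (tl xs) \<and> \<not> avoids T w xs} \<union> {xs. ?D xs}" by auto
  also have "measure_pmf.prob (tosses q (Suc n)) \<dots> \<le> first_prob q T w n +
      measure_pmf.prob (tosses q (Suc n)) {xs. ?D xs}"
    unfolding first_prob_def by (rule measure_Un_le) auto
  also have "measure_pmf.prob (tosses q (Suc n)) {xs. ?D xs} =
      few_prob q T w * measure_pmf.prob (tosses q (2 * w + s)) {xs. \<not> avoids T w (take (2 * w) xs)}"
    unfolding s few_prob_def by (rule prob_tosses_split)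
  also have "measure_pmf.prob (tosses q (2 * w + s)) {xs. \<not> avoids T w (take (2 * w) xs)} =
      measure_pmf.prob (tosses q (2 * w)) {xs. \<not> avoids T w xs}"
    by (rule prob_tosses_take)
  also have "\<dots> = 1 - avoid_prob q T w (2 * w)"
    using measure_pmf.prob_compl[of "{xs. avoids T w xs}" "tosses q (2 * w)"]
    unfolding avoid_prob_def by (simp add: Compl_eq_Diff_UNIV[symmetric] Collect_neg_eq)
  also have "few_prob q T w * \<dots> \<le> few_prob q T w * (real (2 * w) * few_prob q T w)"
    by (intro mult_left_mono avoid_prob_ge few_prob_nonneg assms)
  finally show ?thesis by (simp add: power2_eq_square algebra_simps)
qed

text \<open>Replacing \<open>avoid_prob q T w r\<close> by \<open>avoid_prob q T w n\<close> costs
  \<open>2 * w - 1\<close> steps of the recursion, each at most \<open>few_prob\<close>, times a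
  factor that is again at most \<open>few_prob\<close>. This error and the one of
  \<open>first_prob_lower\<close> point in opposite directions, so they do not add up.\<close>

lemma first_prob_approx:
  assumes "w \<ge> 1" "Suc n \<ge> 3 * w"
  shows "\<bar>first_prob q T w n - first_prob q T w (2 * w - 1) * avoid_prob q T w n\<bar>
           \<le> 2 * real w * (few_prob q T w)^2"
proof -
  define r where "r = Suc n - 2 * w"
  have r: "Suc n = 2 * w + r" "r \<ge> w" using assms by (auto simp: r_def)
  let ?b = "first_prob q T w (2 * w - 1)" and ?a = "few_prob q T w"
  have n: "n = r + (2 * w - 1)" using r assms by simp
  have 1: "avoid_prob q T w n \<le> avoid_prob q T w r" by (rule avoid_prob_antimono) (use n in simp)
  have 2: "avoid_prob q T w r \<le> avoid_prob q T w n + real (2 * w - 1) * ?a"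
    using avoid_prob_add_ge[of q T w r "2 * w - 1"] n by simp
  have b: "0 \<le> ?b" "?b \<le> ?a" by (rule first_prob_nonneg first_prob_le_few)+
  have "?b * avoid_prob q T w r \<le> ?b * avoid_prob q T w n + ?b * (real (2 * w - 1) * ?a)"
    using mult_left_mono[OF 2 b(1)] by (simp add: algebra_simps)
  also have "?b * (real (2 * w - 1) * ?a) \<le> ?a * (2 * real w * ?a)"
    using b by (intro mult_mono) (auto simp: few_prob_nonneg)
  finally have "?b * avoid_prob q T w r \<le> ?b * avoid_prob q T w n + 2 * real w * ?a^2"
    by (simp add: power2_eq_square algebra_simps)
  moreover have "?b * avoid_prob q T w n \<le> ?b * avoid_prob q T w r"
    using 1 b(1) by (rule mult_left_mono)
  ultimately show ?thesis
    using first_prob_upper[OF assms(1) r(1), of q T] first_prob_lower[OF assms(1) r, of q T] by linarith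
qed

text \<open>The recursion is multiplication by \<open>1 - \<beta>\<close> up to a step error, and
  this factor does not amplify earlier errors, so that step errors simply accumulate. The term with
  \<open>min\<close> pays for the initial steps, where the list is too short for
  \<open>first_prob_approx\<close>.\<close>

lemma avoid_prob_approx_power:
  assumes "w \<ge> 1"
  shows "\<bar>avoid_prob q T w n - (1 - first_prob q T w (2 * w - 1)) ^ n\<bar>
           \<le> real (min n (3 * w)) * few_prob q T w + real n * (2 * real w * (few_prob q T w)^2)"
proof (induction n)
  case 0
  show ?case using assms by (simp add: avoid_prob_def tosses_def avoids_def)
next
  case (Suc n)
  let ?b = "first_prob q T w (2 * w - 1)" and ?a = "few_prob q T w" and ?f = "avoid_prob q T w n"
  let ?d = "2 * real w * (few_prob q T w)^2"
  have b: "0 \<le> ?b" "?b \<le> ?a" "?a \<le> 1" by (rule first_prob_nonneg first_prob_le_few few_prob_le_1)+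
  have "\<bar>(1 - ?b) * (?f - (1 - ?b) ^ n)\<bar> \<le> 1 * \<bar>?f - (1 - ?b) ^ n\<bar>"
    unfolding abs_mult using b by (intro mult_right_mono) auto
  moreover have "\<bar>avoid_prob q T w (Suc n) - (1 - ?b) ^ Suc n\<bar> \<le>
      \<bar>(1 - ?b) * (?f - (1 - ?b) ^ n)\<bar> + \<bar>first_prob q T w n - ?b * ?f\<bar>"
  proof -
    have "avoid_prob q T w (Suc n) - (1 - ?b) ^ Suc n =
      (1 - ?b) * (?f - (1 - ?b) ^ n) - (first_prob q T w n - ?b * ?f)"
      by (simp add: avoid_prob_Suc algebra_simps)
    then show ?thesis by (metis abs_triangle_ineq4)
  qed
  moreover have "\<bar>first_prob q T w n - ?b * ?f\<bar> \<le> real (min (Suc n) (3 * w)) * ?a - real (min n (3 * w)) * ?a + ?d"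
  proof (cases "Suc n \<ge> 3 * w")
    case True
    have "0 \<le> real (min (Suc n) (3 * w)) * ?a - real (min n (3 * w)) * ?a"
      by (simp add: mult_right_mono few_prob_nonneg min_def)
    then show ?thesis using first_prob_approx[OF assms True, of q T] by linarith
  next
    \<comment> \<open>Both quantities lie between 0 and \<open>few_prob\<close>, which is exactly
      the increment of the \<open>min\<close> term.\<close>
    case False
    then have "real (min (Suc n) (3 * w)) * ?a - real (min n (3 * w)) * ?a = ?a"
      by (simp add: algebra_simps)
    moreover have "0 \<le> ?b * ?f" "?b * ?f \<le> ?a * 1"
      using b by (intro mult_nonneg_nonneg mult_mono avoid_prob_nonneg avoid_prob_le_1; simp)+
    moreover have "0 \<le> first_prob q T w n" "first_prob q T w n \<le> ?a"
      by (rule first_prob_nonneg first_prob_le_few)+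
    moreover have "0 \<le> ?d" by simp
    ultimately show ?thesis by linarith
  qed
  moreover have "real (Suc n) * ?d = real n * ?d + ?d" by (simp add: algebra_simps)
  ultimately show ?case using Suc.IH by argo
qed

text \<open>Powers of two numbers in the unit interval differ by at most \<open>n\<close> times the
  difference of the bases, here at most \<open>\<beta>^2\<close>; since \<open>w \<ge> 1\<close>,
  this is absorbed by raising the constant from 2 to 3.\<close>

lemma avoid_prob_approx_exp:
  assumes "w \<ge> 1"
  shows "\<bar>avoid_prob q T w n - exp (- (real n * first_prob q T w (2 * w - 1)))\<bar>
           \<le> 3 * real w * few_prob q T w + 3 * real n * real w * (few_prob q T w)^2"
proof -
  let ?b = "first_prob q T w (2 * w - 1)" and ?a = "few_prob q T w"
  have b: "0 \<le> ?b" "?b \<le> ?a" "?a \<le> 1" by (rule first_prob_nonneg first_prob_le_few few_prob_le_1)+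
  have "?b^2 \<le> ?a^2" using b by (intro power_mono) auto
  then have e: "\<bar>(1 - ?b) - exp (- ?b)\<bar> \<le> ?a^2"
    using abs_exp_minus_one_minus[OF b(1)] by linarith
  have "\<bar>(1 - ?b)^n - exp (- ?b)^n\<bar> \<le> real n * \<bar>(1 - ?b) - exp (- ?b)\<bar>"
    using norm_power_diff[of "1 - ?b" "exp (- ?b)" n] b by simp
  also have "\<dots> \<le> real n * ?a^2" using e by (intro mult_left_mono) auto
  also have "\<dots> \<le> real n * (real w * ?a^2)"
    using assms mult_right_mono[of 1 "real w" "?a^2"] by (intro mult_left_mono) auto
  finally have "\<bar>(1 - ?b)^n - exp (- (real n * ?b))\<bar> \<le> real n * (real w * ?a^2)"
    by (simp add: exp_of_nat_mult[symmetric])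
  moreover have "real (min n (3 * w)) * ?a \<le> 3 * real w * ?a"
    by (intro mult_right_mono) (auto simp: few_prob_nonneg)
  ultimately show ?thesis using avoid_prob_approx_power[OF assms, of q T n] by argo
qed

section \<open>The probability of a first occurrence\<close>

lemma count_list_conv_card: "count_list xs True = card {i. i < length xs \<and> xs ! i}"
proof -
  have "count_list xs True = length (filter id xs)" by (induction xs) auto
  then show ?thesis by (simp add: length_filter_conv_card)
qed

lemma count_list_take_conv_card:
  "count_list (take j xs) True = card ({i. i < length xs \<and> xs ! i} \<inter> {..<j})"
  unfolding count_list_conv_card by (rule arg_cong[of _ _ card]) auto

lemma few_prob_eq_sum:
  assumes "0 \<le> q" "q \<le> 1"
  shows "few_prob q T w = (\<Sum>k\<le>T. real (w choose k) * q ^ k * (1 - q) ^ (w - k))"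
proof -
  have "few_prob q T w = measure_pmf.prob (binomial_pmf w q) {..T}"
  proof -
    have "count_list xs True = length (filter id xs)" for xs by (induction xs) auto
    then show ?thesis using assms
      by (simp add: few_prob_def tosses_def binomial_pmf_altdef vimage_def)
  qed
  also have "\<dots> = (\<Sum>k\<le>T. pmf (binomial_pmf w q) k)"
    by (simp add: measure_measure_pmf_finite)
  finally show ?thesis using assms by simp
qed

text \<open>The order of magnitude is enough, because \<open>few_prob\<close> occurs only in error
  terms; the sharp expansion is needed for \<open>first_prob\<close> alone.\<close>

lemma few_prob_le:
  assumes "0 < q" "q < 1" "1 \<le> w" "T \<le> w"
  shows "few_prob q T w \<le> real (Suc T) * real w ^ T * (1 - q) ^ (w - T)"
proof -
  have "few_prob q T w = (\<Sum>k\<le>T. real (w choose k) * q ^ k * (1 - q) ^ (w - k))"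
    using assms by (intro few_prob_eq_sum) auto
  also have "\<dots> \<le> (\<Sum>k\<le>T. real w ^ T * (1 - q) ^ (w - T))"
  proof (intro sum_mono)
    fix k assume k: "k \<in> {..T}"
    have "w choose k \<le> w ^ k" using k assms by (intro binomial_le_pow) auto
    then have "real (w choose k) \<le> real w ^ k" by (metis of_nat_le_iff of_nat_power)
    also have "\<dots> \<le> real w ^ T" using k assms by (intro power_increasing) auto
    finally have "real (w choose k) * q ^ k \<le> real w ^ T * 1"
      using assms by (intro mult_mono power_le_one) auto
    moreover have "(1 - q) ^ (w - k) \<le> (1 - q) ^ (w - T)"
      using k assms by (intro power_decreasing) auto
    ultimately show "real (w choose k) * q ^ k * (1 - q) ^ (w - k) \<le> real w ^ T * (1 - q) ^ (w - T)"
      using assms by (intro mult_mono) auto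
  qed
  also have "\<dots> = real (Suc T) * real w ^ T * (1 - q) ^ (w - T)" by simp
  finally show ?thesis .
qed

text \<open>Sliding the window by \<open>j\<close> towards older tosses loses the first
  \<open>j\<close> tosses of \<open>v\<close> and gains the first \<open>j\<close> of
  \<open>u\<close>. So the older windows have more than \<open>T\<close> tails iff the gains always
  exceed the losses, once \<open>v\<close> is known to have exactly \<open>T\<close> tails.\<close>

lemma first_occurrence_iff:
  assumes "length v = w" "length u = w" "w \<ge> 1"
  shows "avoids T w (tl (v @ u)) \<and> \<not> avoids T w (v @ u) \<longleftrightarrow>
     count_list v True = T \<and> (\<forall>j\<in>{1..w}. count_list (take j v) True < count_list (take j u) True)"
proof -
  have window: "count_list (take w (drop j (v @ u))) True + count_list (take j v) True
      = count_list v True + count_list (take j u) True" if "j \<le> w" for j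
    using that assms count_list_append[of "take j v" "drop j v" True] by simp
  have tl: "avoids T w (tl (v @ u)) \<longleftrightarrow> (\<forall>j\<in>{1..w}. T < count_list (take w (drop j (v @ u))) True)"
    (is "_ \<longleftrightarrow> ?A")
  proof -
    have "tl (v @ u) = drop 1 (v @ u)" by (metis drop_0 drop_Suc One_nat_def)
    then have "avoids T w (tl (v @ u)) \<longleftrightarrow>
        (\<forall>i. i + w \<le> 2 * w - 1 \<longrightarrow> T < count_list (take w (drop (i + 1) (v @ u))) True)"
      using assms unfolding avoids_def by (simp add: mult_2)
    also have "\<dots> \<longleftrightarrow> ?A"
    proof (intro iffI allI impI ballI)
      fix j assume A: "\<forall>i. i + w \<le> 2 * w - 1 \<longrightarrow> T < count_list (take w (drop (i + 1) (v @ u))) True"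
        and j: "j \<in> {1..w}"
      then show "T < count_list (take w (drop j (v @ u))) True"
        using A[rule_format, of "j - 1"] by auto
    next
      fix i assume "?A" "i + w \<le> 2 * w - 1"
      then show "T < count_list (take w (drop (i + 1) (v @ u))) True"
        using assms(3) by (auto dest!: bspec[of _ _ "i + 1"])
    qed
    finally show ?thesis .
  qed
  have hd: "avoids T w (v @ u) \<longleftrightarrow> avoids T w (tl (v @ u)) \<and> T < count_list v True"
    using assms by (cases v) (auto simp: avoids_Cons)
  show ?thesis
  proof
    assume L: "avoids T w (tl (v @ u)) \<and> \<not> avoids T w (v @ u)"
    then have le: "count_list v True \<le> T" using hd by auto
    have gt: "T < count_list (take w (drop j (v @ u))) True" if "j \<in> {1..w}" for j
      using that L tl by auto
    \<comment> \<open>A single shift gains at most one tail and must lead from at most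
      \<open>T\<close> to more than \<open>T\<close>; this forces equality.\<close>
    have "count_list (take 1 u) True \<le> 1"
      by (rule order_trans[OF count_le_length]) simp
    with gt[of 1] window[of 1] assms(3) have "count_list v True = T"
      using le by simp
    with gt window show "count_list v True = T \<and>
        (\<forall>j\<in>{1..w}. count_list (take j v) True < count_list (take j u) True)"
      by (metis add_less_cancel_left add.commute atLeastAtMost_iff)
  next
    assume R: "count_list v True = T \<and> (\<forall>j\<in>{1..w}. count_list (take j v) True < count_list (take j u) True)"
    have "T < count_list (take w (drop j (v @ u))) True" if "j \<in> {1..w}" for j
      using window[of j] R that by (metis add_less_cancel_left add.commute atLeastAtMost_iff)
    with R hd tl show "avoids T w (tl (v @ u)) \<and> \<not> avoids T w (v @ u)" by auto
  qed
qed

lemma prob_tosses_sum: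
  "measure_pmf.prob (tosses q (m + n)) {xs. R (take m xs) (drop m xs)} =
     (\<Sum>v | length v = m. pmf (tosses q m) v * measure_pmf.prob (tosses q n) {u. R v u})"
proof -
  have fin: "finite {v :: bool list. length v = m}"
    using finite_lists_length_eq[of "UNIV :: bool set" m] by simp
  have "measure_pmf.prob (tosses q (m + n)) {xs. R (take m xs) (drop m xs)} =
      measure_pmf.prob (tosses q (m + n)) {xs. \<exists>v\<in>{v. length v = m}. take m xs = v \<and> R v (drop m xs)}"
    by (intro prob_tosses_cong) auto
  also have "{xs. \<exists>v\<in>{v. length v = m}. take m xs = v \<and> R v (drop m xs)} =
      (\<Union>v\<in>{v. length v = m}. {xs. take m xs = v \<and> R v (drop m xs)})" by blast
  also have "measure_pmf.prob (tosses q (m + n)) \<dots> =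
      (\<Sum>v | length v = m. measure_pmf.prob (tosses q (m + n)) {xs. take m xs = v \<and> R v (drop m xs)})"
    using fin by (intro measure_pmf.finite_measure_finite_Union) (auto simp: disjoint_family_on_def)
  also have "\<dots> = (\<Sum>v | length v = m. pmf (tosses q m) v * measure_pmf.prob (tosses q n) {u. R v u})"
    by (intro sum.cong refl, subst prob_tosses_split) (simp add: measure_pmf_single)
  finally show ?thesis .
qed

text \<open>Here \<open>I\<close> is the set of positions of the tails in the newest window. The older windows
  all have more than \<open>T\<close> tails iff the tails of the preceding block stay strictly ahead of those
  of \<open>I\<close>.\<close>

definition lead_prob :: "real \<Rightarrow> nat \<Rightarrow> nat set \<Rightarrow> real" where
  "lead_prob q w I =
     measure_pmf.prob (tosses q w) {u. \<forall>j\<in>{1..w}. card (I \<inter> {..<j}) < count_list (take j u) True}"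

lemma pmf_tosses:
  assumes "0 \<le> q" "q \<le> 1"
  shows "pmf (tosses q (length bs)) bs = (\<Prod>i<length bs. if bs ! i then q else 1 - q)"
proof (induction bs)
  case (Cons b bs)
  have "tosses q (length (b # bs)) = map_pmf (\<lambda>(x, xs). x # xs) (pair_pmf (bernoulli_pmf q) (tosses q (length bs)))"
    by (simp add: tosses_def map_pmf_def pair_pmf_def bind_assoc_pmf bind_return_pmf)
  moreover have "inj (\<lambda>(x :: bool, xs). x # xs)" by (auto simp: inj_def)
  ultimately have "pmf (tosses q (length (b # bs))) (b # bs) = pmf (pair_pmf (bernoulli_pmf q) (tosses q (length bs))) (b, bs)"
    using pmf_map_inj'[of "\<lambda>(x :: bool, xs). x # xs" _ "(b, bs)"] by simp
  also have "\<dots> = (if b then q else 1 - q) * (\<Prod>i<length bs. if bs ! i then q else 1 - q)"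
    using assms Cons.IH by (simp add: pmf_pair)
  also have "\<dots> = (\<Prod>i<length (b # bs). if (b # bs) ! i then q else 1 - q)"
    by (simp add: prod.lessThan_Suc_shift del: prod.lessThan_Suc)
  finally show ?case .
qed (simp add: tosses_def)

lemma pmf_tosses_count:
  assumes "0 \<le> q" "q \<le> 1"
  shows "pmf (tosses q (length v)) v = q ^ count_list v True * (1 - q) ^ (length v - count_list v True)"
  unfolding pmf_tosses[OF assms]
proof (induction v)
  case (Cons b bs)
  then show ?case
    using count_le_length[of bs True]
    by (simp add: prod.lessThan_Suc_shift Suc_diff_le del: prod.lessThan_Suc)
qed simp

text \<open>Condition on the newest window: all windows with \<open>T\<close> tails have the same
  weight, and the condition on the preceding block depends only on the set of tail
  positions.\<close>

lemma first_prob_eq_sum: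
  assumes "0 \<le> q" "q \<le> 1" "w \<ge> 1"
  shows "first_prob q T w (2 * w - 1) =
     q ^ T * (1 - q) ^ (w - T) * (\<Sum>I | I \<subseteq> {..<w} \<and> card I = T. lead_prob q w I)"
proof -
  let ?R = "\<lambda>v u. count_list v True = T \<and> (\<forall>j\<in>{1..w}. count_list (take j v) True < count_list (take j u) True)"
  let ?Z = "\<lambda>v. {i. i < length v \<and> v ! i}"
  have fin: "finite {v :: bool list. length v = w}"
    using finite_lists_length_eq[of "UNIV :: bool set" w] by simp
  have e: "Suc (2 * w - 1) = w + w" using assms by simp
  have "first_prob q T w (2 * w - 1) = measure_pmf.prob (tosses q (w + w)) {xs. ?R (take w xs) (drop w xs)}"
    unfolding first_prob_def e
  proof (rule prob_tosses_cong)
    fix xs :: "bool list" assume "length xs = w + w"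
    then show "avoids T w (tl xs) \<and> \<not> avoids T w xs \<longleftrightarrow> ?R (take w xs) (drop w xs)"
      using first_occurrence_iff[of "take w xs" w "drop w xs" T] assms by simp
  qed
  also have "\<dots> = (\<Sum>v | length v = w. pmf (tosses q w) v * measure_pmf.prob (tosses q w) {u. ?R v u})"
    by (rule prob_tosses_sum)
  also have "\<dots> = (\<Sum>v | length v = w \<and> count_list v True = T.
      pmf (tosses q w) v * measure_pmf.prob (tosses q w) {u. ?R v u})"
    by (rule sum.mono_neutral_right) (auto simp: fin)
  also have "\<dots> = (\<Sum>v | length v = w \<and> count_list v True = T. q ^ T * (1 - q) ^ (w - T) * lead_prob q w (?Z v))"
  proof (intro sum.cong refl)
    fix v assume v: "v \<in> {v. length v = w \<and> count_list v True = T}"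
    then have "pmf (tosses q w) v = q ^ T * (1 - q) ^ (w - T)"
      using pmf_tosses_count[of q v] assms by auto
    with v show "pmf (tosses q w) v * measure_pmf.prob (tosses q w) {u. ?R v u} =
        q ^ T * (1 - q) ^ (w - T) * lead_prob q w (?Z v)"
      unfolding lead_prob_def count_list_take_conv_card[of _ v] by simp
  qed
  also have "\<dots> = (\<Sum>I | I \<subseteq> {..<w} \<and> card I = T. q ^ T * (1 - q) ^ (w - T) * lead_prob q w I)"
  proof (rule sum.reindex_bij_witness[of _ "\<lambda>I. map (\<lambda>i. i \<in> I) [0..<w]" ?Z])
    fix v assume v: "v \<in> {v. length v = w \<and> count_list v True = T}"
    then show "map (\<lambda>i. i \<in> ?Z v) [0..<w] = v" by (auto intro!: nth_equalityI)
    show "?Z v \<in> {I. I \<subseteq> {..<w} \<and> card I = T}" using v by (auto simp: count_list_conv_card)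
  next
    fix I assume I: "I \<in> {I. I \<subseteq> {..<w} \<and> card I = T}"
    then show Z: "?Z (map (\<lambda>i. i \<in> I) [0..<w]) = I" by auto
    show "map (\<lambda>i. i \<in> I) [0..<w] \<in> {v. length v = w \<and> count_list v True = T}"
      using I unfolding count_list_conv_card mem_Collect_eq Z by simp
  qed auto
  also have "\<dots> = q ^ T * (1 - q) ^ (w - T) * (\<Sum>I | I \<subseteq> {..<w} \<and> card I = T. lead_prob q w I)"
    by (rule sum_distrib_left[symmetric])
  finally show ?thesis .
qed

section \<open>Lead probability of a fixed set of tail positions\<close>

lemma prob_tosses_few_compl:
  "measure_pmf.prob (tosses q n) {u. k < count_list u True} = 1 - few_prob q k n"
  using measure_pmf.prob_compl[of "{u. count_list u True \<le> k}" "tosses q n"]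
  by (simp add: few_prob_def Compl_eq_Diff_UNIV[symmetric] Collect_neg_eq[symmetric] not_le)

lemma prob_toss_1:
  assumes "0 \<le> q" "q \<le> 1"
  shows "measure_pmf.prob (tosses q 1) {u. 0 < count_list u True} = q"
  using assms by (simp add: prob_tosses_few_compl few_prob_eq_sum)

text \<open>At \<open>j = 1\<close> the preceding block would need two tails in its first
  toss.\<close>

lemma lead_prob_zero:
  assumes "0 \<in> I" "w \<ge> 1" shows "lead_prob q w I = 0"
proof -
  have "lead_prob q w I \<le> measure_pmf.prob (tosses q w) {u. False}"
    unfolding lead_prob_def
  proof (rule prob_tosses_mono)
    fix u :: "bool list"
    assume a: "\<forall>j\<in>{1..w}. card (I \<inter> {..<j}) < count_list (take j u) True"
    have "I \<inter> {..<1} = {0}" using assms by auto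
    then have "card (I \<inter> {..<1}) = 1" by simp
    moreover have "count_list (take 1 u) True \<le> 1"
      by (rule order_trans[OF count_le_length]) simp
    moreover have "1 \<in> {1..w}" using assms by simp
    ultimately show False using a by fastforce
  qed
  then show ?thesis by (simp add: lead_prob_def measure_le_0_iff)
qed

text \<open>Only two of the conditions are kept: at \<open>j = 1\<close> the first toss must be a
  tail, and at \<open>j = Suc i\<close> a second tail must have appeared among the next
  \<open>i\<close> tosses.\<close>

lemma lead_prob_le:
  assumes q: "0 \<le> q" "q \<le> 1" and I: "I \<subseteq> {1..<w}" "i \<in> I"
  shows "lead_prob q w I \<le> q * (1 - few_prob q 0 i)"
proof -
  obtain s where s: "w = 1 + (i + s)" using I by (auto simp: less_iff_Suc_add dest!: subsetD)
  have "lead_prob q w I \<le> measure_pmf.prob (tosses q w)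
     {u. 0 < count_list (take 1 u) True \<and> 0 < count_list (take i (drop 1 u)) True}"
    unfolding lead_prob_def
  proof (rule prob_tosses_mono)
    fix u :: "bool list"
    assume a: "\<forall>j\<in>{1..w}. card (I \<inter> {..<j}) < count_list (take j u) True"
    have "1 \<in> {1..w}" "Suc i \<in> {1..w}" using s by auto
    with a have 1: "0 < count_list (take 1 u) True"
      and 2: "card (I \<inter> {..<Suc i}) < count_list (take (Suc i) u) True" by fastforce+
    have "0 < card (I \<inter> {..<Suc i})" using I by (auto simp: card_gt_0_iff)
    moreover have "count_list (take 1 u) True \<le> 1"
      by (rule order_trans[OF count_le_length]) simp
    moreover have "take (Suc i) u = take 1 u @ take i (drop 1 u)"
      using take_add[of 1 i u] by simp
    ultimately show "0 < count_list (take 1 u) True \<and> 0 < count_list (take i (drop 1 u)) True"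
      using 1 2 by simp
  qed
  also have "\<dots> = q * measure_pmf.prob (tosses q (i + s)) {u. 0 < count_list (take i u) True}"
    unfolding s by (subst prob_tosses_split) (simp add: prob_toss_1[OF q, simplified])
  also have "\<dots> = q * (1 - few_prob q 0 i)"
    by (subst prob_tosses_take) (simp only: prob_tosses_few_compl)
  finally show ?thesis .
qed

text \<open>Given a tail in the first toss, the lead can only be lost just after an element of
  \<open>I\<close>. It survives if, for each \<open>i\<close> in \<open>I\<close>, the
  \<open>i\<close> tosses after the first contain more tails than \<open>I\<close> has elements
  below \<open>i\<close>; a union bound over the failures gives the estimate.\<close>

lemma lead_prob_ge:
  assumes q: "0 \<le> q" "q \<le> 1" and I: "I \<subseteq> {1..<w}" and w: "w \<ge> 1"
  shows "q * (1 - (\<Sum>i\<in>I. few_prob q (card (I \<inter> {..<i})) i)) \<le> lead_prob q w I"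
proof -
  have fin: "finite I" using I finite_subset by blast
  let ?n = "w - 1"
  let ?P = "\<lambda>u. \<forall>i\<in>I. card (I \<inter> {..<i}) < count_list (take i u) True"
  let ?F = "\<lambda>i. {u. count_list (take i u) True \<le> card (I \<inter> {..<i})}"
  have "1 - measure_pmf.prob (tosses q ?n) {u. ?P u} = measure_pmf.prob (tosses q ?n) (UNIV - {u. ?P u})"
    using measure_pmf.prob_compl[of "{u. ?P u}" "tosses q ?n"] by simp
  also have "UNIV - {u. ?P u} = (\<Union>i\<in>I. ?F i)" by (auto simp: not_less)
  also have "measure_pmf.prob (tosses q ?n) \<dots> \<le> (\<Sum>i\<in>I. measure_pmf.prob (tosses q ?n) (?F i))"
    using fin by (intro measure_pmf.finite_measure_subadditive_finite) auto
  also have "\<dots> = (\<Sum>i\<in>I. few_prob q (card (I \<inter> {..<i})) i)"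
  proof (intro sum.cong refl)
    fix i assume "i \<in> I"
    then have "i < w" using I by auto
    then obtain s where s: "?n = i + s" by (auto simp: less_iff_Suc_add)
    show "measure_pmf.prob (tosses q ?n) (?F i) = few_prob q (card (I \<inter> {..<i})) i"
      unfolding few_prob_def s by (rule prob_tosses_take)
  qed
  finally have "q * (1 - (\<Sum>i\<in>I. few_prob q (card (I \<inter> {..<i})) i)) \<le> q * measure_pmf.prob (tosses q ?n) {u. ?P u}"
    using q by (intro mult_left_mono) auto
  also have "\<dots> = measure_pmf.prob (tosses q (1 + ?n)) {u. 0 < count_list (take 1 u) True \<and> ?P (drop 1 u)}"
    by (subst prob_tosses_split) (simp add: prob_toss_1[OF q, simplified])
  also have "\<dots> \<le> measure_pmf.prob (tosses q (1 + ?n)) {u. \<forall>j\<in>{1..w}. card (I \<inter> {..<j}) < count_list (take j u) True}"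
  proof (rule prob_tosses_mono, intro ballI)
    fix u :: "bool list" and j
    assume a: "0 < count_list (take 1 u) True \<and> ?P (drop 1 u)" and j: "j \<in> {1..w}"
    have "take j u = take 1 u @ take (j - 1) (drop 1 u)"
      using take_add[of 1 "j - 1" u] j by simp
    then have c: "count_list (take j u) True \<ge> Suc (count_list (take (j - 1) (drop 1 u)) True)"
      using a by simp
    show "card (I \<inter> {..<j}) < count_list (take j u) True"
    proof (cases "I \<inter> {..<j} = {}")
      case True
      then show ?thesis using c by simp
    next
      case False
      \<comment> \<open>Between this last element of \<open>I\<close> and \<open>j\<close> the
        number to be beaten is constant, while the count of tails can only grow.\<close>
      define i where "i = Max (I \<inter> {..<j})"
      have i: "i \<in> I" "i < j" using Max_in[of "I \<inter> {..<j}"] False fin by (auto simp: i_def)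
      have "I \<inter> {..<j} = insert i (I \<inter> {..<i})"
      proof (rule set_eqI)
        fix x show "x \<in> I \<inter> {..<j} \<longleftrightarrow> x \<in> insert i (I \<inter> {..<i})"
          using i Max_ge[of "I \<inter> {..<j}" x] fin by (auto simp: i_def[symmetric])
      qed
      then have "card (I \<inter> {..<j}) = Suc (card (I \<inter> {..<i}))" using fin by simp
      also have "\<dots> \<le> count_list (take i (drop 1 u)) True" using a i by (simp add: Suc_le_eq)
      also have "\<dots> \<le> count_list (take (j - 1) (drop 1 u)) True"
      proof -
        have "take (j - 1) (drop 1 u) = take i (drop 1 u) @ take (j - 1 - i) (drop i (drop 1 u))"
          using take_add[of i "j - 1 - i" "drop 1 u"] i by simp
        then show ?thesis by simp
      qed
      finally show ?thesis using c by simp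
    qed
  qed
  finally show ?thesis using w by (simp add: lead_prob_def)
qed

section \<open>Geometric sums\<close>

lemma Suc_mult_power_sum_le:
  fixes r :: real assumes "0 \<le> r" "r < 1"
  shows "(\<Sum>n<m. real (Suc n) * r ^ n) \<le> 1 / (1 - r)^2"
proof -
  have s: "(\<lambda>n. real (Suc n) * r ^ n) sums (1 / (1 - r)^2)"
    using geometric_deriv_sums[of r] assms by simp
  then have "(\<Sum>n<m. real (Suc n) * r ^ n) \<le> (\<Sum>n. real (Suc n) * r ^ n)"
    using assms by (intro sum_le_suminf) (auto simp: sums_iff)
  with s show ?thesis by (simp add: sums_iff)
qed

lemma Suc_mult_power_le:
  fixes r :: real assumes "0 \<le> r" "r < 1"
  shows "real (Suc n) * r ^ n \<le> 1 / (1 - r)^2"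
proof -
  have "real (Suc n) * r ^ n \<le> (\<Sum>k<Suc n. real (Suc k) * r ^ k)"
    using assms by (intro member_le_sum) auto
  also have "\<dots> \<le> 1 / (1 - r)^2" by (rule Suc_mult_power_sum_le[OF assms])
  finally show ?thesis .
qed

text \<open>Write \<open>p ^ n\<close> as a product of two powers of \<open>sqrt p\<close>: one
  factor \<open>Suc n * sqrt p ^ n\<close> is bounded uniformly, the other is summed, and each
  contributes \<open>1 / (1 - sqrt p)^2\<close>.\<close>

lemma Suc_square_mult_power_sum_le:
  fixes p :: real assumes "0 \<le> p" "p < 1"
  shows "(\<Sum>n<m. (real (Suc n))^2 * p ^ n) \<le> (1 / (1 - sqrt p)^2)^2"
proof -
  let ?r = "sqrt p" and ?B = "1 / (1 - sqrt p)^2"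
  have r: "0 \<le> ?r" "?r < 1" using assms by auto
  have "(\<Sum>n<m. (real (Suc n))^2 * p ^ n) = (\<Sum>n<m. (real (Suc n) * ?r ^ n) * (real (Suc n) * ?r ^ n))"
  proof (intro sum.cong refl)
    fix n
    have "p ^ n = ?r ^ n * ?r ^ n" using assms by (simp flip: power_mult_distrib)
    then show "(real (Suc n))^2 * p ^ n = (real (Suc n) * ?r ^ n) * (real (Suc n) * ?r ^ n)"
      by (simp only: power2_eq_square mult_ac)
  qed
  also have "\<dots> \<le> (\<Sum>n<m. ?B * (real (Suc n) * ?r ^ n))"
    using r by (intro sum_mono mult_right_mono Suc_mult_power_le) auto
  also have "\<dots> = ?B * (\<Sum>n<m. real (Suc n) * ?r ^ n)" by (rule sum_distrib_left[symmetric])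
  also have "\<dots> \<le> ?B * ?B" using r by (intro mult_left_mono Suc_mult_power_sum_le) auto
  finally show ?thesis by (simp add: power2_eq_square)
qed

lemma few_prob_0: "0 \<le> q \<Longrightarrow> q \<le> 1 \<Longrightarrow> few_prob q 0 n = (1 - q) ^ n"
  by (simp add: few_prob_eq_sum)

lemma few_prob_1_le:
  assumes "0 \<le> q" "q \<le> 1"
  shows "few_prob q 1 (Suc n) \<le> 2 * real (Suc n) * (1 - q) ^ n"
proof -
  have "few_prob q 1 (Suc n) = (1 - q) ^ Suc n + real (Suc n) * q * (1 - q) ^ n"
    using assms by (simp add: few_prob_eq_sum)
  moreover have "(1 - q) ^ Suc n \<le> 1 * (1 - q) ^ n" using assms by (simp add: mult_left_le_one_le)
  moreover have "1 * (1 - q) ^ n \<le> real (Suc n) * (1 - q) ^ n"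
    using assms by (intro mult_right_mono) auto
  moreover have "real (Suc n) * q * (1 - q) ^ n \<le> real (Suc n) * 1 * (1 - q) ^ n"
    using assms by (intro mult_right_mono mult_left_mono) auto
  ultimately show ?thesis by linarith
qed

section \<open>Summation over tail positions for one and two tails\<close>

lemma sum_one_minus_power:
  fixes p :: real assumes "p \<noteq> 1"
  shows "(\<Sum>i\<in>{1..<Suc n}. (1 - p ^ i)) = real n - (p - p ^ Suc n) / (1 - p)"
  using assms by (induction n) (auto simp: field_simps)

text \<open>For a singleton the bounds of \<open>lead_prob_le\<close> and
  \<open>lead_prob_ge\<close> coincide, so the value is exact; position 0 contributes
  nothing.\<close>

lemma lead_prob_sum_1:
  assumes "0 \<le> q" "q \<le> 1" "w \<ge> 1"
  shows "(\<Sum>I | I \<subseteq> {..<w} \<and> card I = 1. lead_prob q w I) = q * (\<Sum>i\<in>{1..<w}. (1 - (1 - q) ^ i))"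
proof -
  have "(\<Sum>I | I \<subseteq> {..<w} \<and> card I = 1. lead_prob q w I) = (\<Sum>i<w. lead_prob q w {i})"
    by (rule sum.reindex_bij_witness[of _ "\<lambda>i. {i}" "\<lambda>I. the_elem I"]) (auto simp: card_1_singleton_iff)
  also have "\<dots> = (\<Sum>i\<in>{1..<w}. lead_prob q w {i})"
    using assms by (intro sum.mono_neutral_right) (auto simp: lead_prob_zero not_le)
  also have "\<dots> = (\<Sum>i\<in>{1..<w}. q * (1 - (1 - q) ^ i))"
  proof (intro sum.cong refl antisym)
    fix i assume i: "i \<in> {1..<w}"
    show "lead_prob q w {i} \<le> q * (1 - (1 - q) ^ i)"
      using lead_prob_le[of q "{i}" w i] i assms by (simp add: few_prob_0)
    have "{i} \<inter> {..<i} = {}" by auto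
    then show "q * (1 - (1 - q) ^ i) \<le> lead_prob q w {i}"
      using lead_prob_ge[of q "{i}" w] i assms by (simp add: few_prob_0)
  qed
  finally show ?thesis by (simp add: sum_distrib_left)
qed

text \<open>As the sum is exact, the only error is the geometric remainder
  \<open>p ^ w / (1 - p)\<close>, for which boundedness of \<open>w * p ^ w\<close> is
  enough.\<close>

lemma first_prob_asymp_1:
  assumes p: "0 < p" "p < 1" and w: "w \<ge> 1"
  shows "\<bar>first_prob (1 - p) 1 w (2 * w - 1) - (1 - p)^2 * p ^ (w - 1) * real w * (1 - 1 / (1 - p) / real w)\<bar>
     \<le> 1 / (1 - p)^3 * ((1 - p)^2 * p ^ (w - 1) * real w) / (real w)^2"
proof -
  obtain n where n: "w = Suc n" using w by (cases w) auto
  let ?q = "1 - p"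
  have "first_prob ?q 1 w (2 * w - 1) = ?q * p ^ n * (?q * (real n - (p - p ^ w) / ?q))"
    using first_prob_eq_sum[of ?q w 1] lead_prob_sum_1[of ?q w] sum_one_minus_power[of p n] p w
    by (simp add: n)
  also have "\<dots> = ?q^2 * p ^ n * (real n - (p - p ^ w) / ?q)" by (simp only: power2_eq_square mult_ac)
  also have "real n - (p - p ^ w) / ?q = real w * (1 - 1 / ?q / real w) + p ^ w / ?q"
  proof -
    have "real w * (1 - 1 / ?q / real w) = real w - 1 / ?q" using w by (simp add: right_diff_distrib)
    moreover have "1 / ?q = 1 + p / ?q" using p by (simp add: field_simps)
    ultimately show ?thesis by (simp add: n diff_divide_distrib)
  qed
  finally have "first_prob ?q 1 w (2 * w - 1) - ?q^2 * p ^ n * real w * (1 - 1 / ?q / real w) = ?q^2 * p ^ n * (p ^ w / ?q)"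
    by (simp add: algebra_simps)
  then have "\<bar>first_prob ?q 1 w (2 * w - 1) - ?q^2 * p ^ n * real w * (1 - 1 / ?q / real w)\<bar> = ?q^2 * p ^ n * (p ^ w / ?q)"
    using p by simp
  also have "\<dots> \<le> ?q^2 * p ^ n * (1 / ?q^3 / real w)"
  proof (intro mult_left_mono)
    have "real w * p ^ w \<le> real (Suc n) * p ^ n"
      unfolding n using p by (intro mult_left_mono) (auto simp: mult_left_le_one_le)
    also have "\<dots> \<le> 1 / ?q^2" using p by (intro Suc_mult_power_le) auto
    finally have "p ^ w \<le> 1 / ?q^2 / real w" using w by (subst pos_le_divide_eq) (auto simp: mult.commute)
    then have "p ^ w / ?q \<le> 1 / ?q^2 / real w / ?q" using p by (intro divide_right_mono) auto
    then show "p ^ w / ?q \<le> 1 / ?q^3 / real w" by (simp add: power2_eq_square power3_eq_cube mult_ac)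
  qed (use p in auto)
  also have "\<dots> = 1 / ?q^3 * (?q^2 * p ^ n * real w) / (real w)^2"
    using w by (simp add: power2_eq_square)
  finally show ?thesis by (simp add: n)
qed

lemma sum_pairs:
  "(\<Sum>I | I \<subseteq> {..<w} \<and> card I = 2. g I) = (\<Sum>j<w. \<Sum>i<j. g {i, j :: nat})"
proof -
  have "(\<Sum>I | I \<subseteq> {..<w} \<and> card I = 2. g I) = (\<Sum>(j, i)\<in>(SIGMA j:{..<w}. {..<j}). g {i, j})"
  proof (rule sum.reindex_bij_witness[of _ "\<lambda>(j, i). {i, j}" "\<lambda>I. (Max I, Min I)"])
    fix I assume "I \<in> {I. I \<subseteq> {..<w} \<and> card I = 2}"
    then obtain a b where ab: "I = {a, b}" "a < b" "b < w"
      unfolding card_2_iff by (auto, metis insert_commute linorder_neqE_nat)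
    then show "(case (Max I, Min I) of (j, i) \<Rightarrow> {i, j}) = I"
      "(Max I, Min I) \<in> (SIGMA j:{..<w}. {..<j})"
      "(case (Max I, Min I) of (j, i) \<Rightarrow> g {i, j}) = g I"
      by (auto simp: max_def min_def)
  next
    fix z assume "z \<in> (SIGMA j:{..<w}. {..<j})"
    then obtain a b where "z = (b, a)" "a < b" "b < w" by auto
    then show "(Max (case z of (j, i) \<Rightarrow> {i, j}), Min (case z of (j, i) \<Rightarrow> {i, j})) = z"
      "(case z of (j, i) \<Rightarrow> {i, j}) \<in> {I. I \<subseteq> {..<w} \<and> card I = 2}"
      by (auto simp: max_def min_def)
  qed
  also have "\<dots> = (\<Sum>j<w. \<Sum>i<j. g {i, j})" by (simp add: sum.Sigma)
  finally show ?thesis .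
qed

text \<open>For \<open>i < j\<close> the upper bound keeps only the smaller position
  \<open>i\<close>. The lower bound also loses the event of at most one tail among \<open>j\<close>
  tosses; this decays geometrically in \<open>j\<close>, so its sum over all pairs stays bounded
  while \<open>A\<close> grows like \<open>w^2 / 2\<close>.\<close>

lemma lead_prob_sum_2:
  assumes q: "0 < q" "q \<le> 1" and w: "w \<ge> 1"
  defines "A \<equiv> \<Sum>j<w. \<Sum>i\<in>{1..<j}. (1 - (1 - q) ^ i)"
    and "S \<equiv> \<Sum>I | I \<subseteq> {..<w} \<and> card I = 2. lead_prob q w I"
  shows "S \<le> q * A" and "q * (A - 2 * (1 / (1 - sqrt (1 - q))^2)^2) \<le> S"
proof -
  have "S = (\<Sum>j<w. \<Sum>i<j. lead_prob q w {i, j})" unfolding S_def by (rule sum_pairs)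
  also have "\<dots> = (\<Sum>j<w. \<Sum>i\<in>{1..<j}. lead_prob q w {i, j})"
    using w by (intro sum.cong refl sum.mono_neutral_right) (auto simp: lead_prob_zero not_le)
  finally have S: "S = (\<Sum>j<w. \<Sum>i\<in>{1..<j}. lead_prob q w {i, j})" .
  have "S \<le> (\<Sum>j<w. \<Sum>i\<in>{1..<j}. q * (1 - (1 - q) ^ i))"
    unfolding S
  proof (intro sum_mono)
    fix i j assume ij: "j \<in> {..<w}" "i \<in> {1..<j}"
    show "lead_prob q w {i, j} \<le> q * (1 - (1 - q) ^ i)"
      using lead_prob_le[of q "{i, j}" w i] ij q by (simp add: few_prob_0)
  qed
  then show "S \<le> q * A" by (simp add: A_def sum_distrib_left)
  have "(\<Sum>j<w. \<Sum>i\<in>{1..<j}. few_prob q 1 j) \<le> 2 * (1 / (1 - sqrt (1 - q))^2)^2"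
  proof -
    obtain n where n: "w = Suc n" using w by (cases w) auto
    \<comment> \<open>For \<open>j = Suc m\<close> the inner sum has \<open>m\<close> equal
      terms.\<close>
    have "(\<Sum>j<w. \<Sum>i\<in>{1..<j}. few_prob q 1 j) = (\<Sum>m<n. real m * few_prob q 1 (Suc m))"
      unfolding n by (subst sum.lessThan_Suc_shift) simp
    also have "\<dots> \<le> (\<Sum>m<n. 2 * ((real (Suc m))^2 * (1 - q) ^ m))"
    proof (intro sum_mono)
      fix m
      have "real m * few_prob q 1 (Suc m) \<le> real (Suc m) * (2 * real (Suc m) * (1 - q) ^ m)"
        using q by (intro mult_mono few_prob_1_le few_prob_nonneg) auto
      also have "\<dots> = 2 * ((real (Suc m))^2 * (1 - q) ^ m)" by (simp only: power2_eq_square mult_ac)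
      finally show "real m * few_prob q 1 (Suc m) \<le> 2 * ((real (Suc m))^2 * (1 - q) ^ m)" .
    qed
    also have "\<dots> = 2 * (\<Sum>m<n. (real (Suc m))^2 * (1 - q) ^ m)" by (rule sum_distrib_left[symmetric])
    also have "\<dots> \<le> 2 * (1 / (1 - sqrt (1 - q))^2)^2"
      using q by (intro mult_left_mono Suc_square_mult_power_sum_le) auto
    finally show ?thesis .
  qed
  then have "q * (A - 2 * (1 / (1 - sqrt (1 - q))^2)^2) \<le> q * (A - (\<Sum>j<w. \<Sum>i\<in>{1..<j}. few_prob q 1 j))"
    using q by (intro mult_left_mono) auto
  also have "\<dots> = (\<Sum>j<w. \<Sum>i\<in>{1..<j}. q * (1 - ((1 - q) ^ i + few_prob q 1 j)))"
    by (simp add: A_def sum_distrib_left sum_subtractf algebra_simps sum.distrib)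
  also have "\<dots> \<le> S"
    unfolding S
  proof (intro sum_mono)
    fix i j assume ij: "j \<in> {..<w}" "i \<in> {1..<j}"
    then have "{i, j} \<inter> {..<i} = {}" "{i, j} \<inter> {..<j} = {i}" by auto
    then show "q * (1 - ((1 - q) ^ i + few_prob q 1 j)) \<le> lead_prob q w {i, j}"
      using lead_prob_ge[of q "{i, j}" w] ij q w by (simp add: few_prob_0)
  qed
  finally show "q * (A - 2 * (1 / (1 - sqrt (1 - q))^2)^2) \<le> S" .
qed

lemma sum_sum_one_minus_power:
  fixes p :: real assumes "p \<noteq> 1"
  shows "(\<Sum>j<Suc n. \<Sum>i\<in>{1..<j}. (1 - p ^ i)) =
     real n * (real n - 1) / 2 - real n * p / (1 - p) + p * (1 - p ^ n) / (1 - p)^2"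
proof -
  have "(\<Sum>j<Suc n. \<Sum>i\<in>{1..<j}. (1 - p ^ i)) = (\<Sum>m<n. real m - (p - p ^ Suc m) / (1 - p))"
    by (subst sum.lessThan_Suc_shift) (simp add: sum_one_minus_power[OF assms, unfolded One_nat_def] del: sum.op_ivl_Suc)
  also have "\<dots> = real n * (real n - 1) / 2 - real n * p / (1 - p) + p * (1 - p ^ n) / (1 - p)^2"
  proof (induction n)
    case (Suc n)
    have "p * (1 - p ^ Suc n) / (1 - p)^2 - p * (1 - p ^ n) / (1 - p)^2 = p ^ Suc n * (1 - p) / (1 - p)^2"
      by (simp add: diff_divide_distrib[symmetric] algebra_simps)
    also have "\<dots> = p ^ Suc n / (1 - p)" using assms by (simp add: power2_eq_square)
    finally have "p * (1 - p ^ Suc n) / (1 - p)^2 = p * (1 - p ^ n) / (1 - p)^2 + p ^ Suc n / (1 - p)"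
      by linarith
    moreover have "real (Suc n) * (real (Suc n) - 1) / 2 = real n * (real n - 1) / 2 + real n"
      by (simp add: algebra_simps add_divide_distrib diff_divide_distrib)
    moreover have "real (Suc n) * p / (1 - p) = real n * p / (1 - p) + p / (1 - p)"
      by (simp add: distrib_right add_divide_distrib)
    moreover have "(\<Sum>m<Suc n. real m - (p - p ^ Suc m) / (1 - p)) =
        (\<Sum>m<n. real m - (p - p ^ Suc m) / (1 - p)) + real n - (p / (1 - p) - p ^ Suc n / (1 - p))"
      by (simp add: diff_divide_distrib)
    ultimately show ?case using Suc.IH by linarith
  qed simp
  finally show ?thesis .
qed

text \<open>In \<open>1 + 2 / q\<close> the 1 comes from the number of pairs, and
  \<open>2 / q\<close> from summing \<open>p ^ i\<close> over the smaller position. What remains in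
  the sum is bounded in \<open>w\<close>, hence of relative size \<open>1 / w^2\<close>.\<close>

lemma first_prob_asymp_2:
  assumes p: "0 < p" "p < 1" and q: "q = 1 - p" and w: "w \<ge> 2"
  shows "\<bar>first_prob q 2 w (2 * w - 1) -
       q^3 * p ^ (w - 2) * ((real w)^2 / 2) * (1 - (1 + 2 / q) / real w)\<bar>
     \<le> (4 / q^2 + 4 * (1 / (1 - sqrt p)^2)^2) * (q^3 * p ^ (w - 2) * ((real w)^2 / 2)) / (real w)^2"
proof -
  obtain n where n: "w = Suc n" using w by (cases w) auto
  define B where "B = (1 / (1 - sqrt p)^2)^2"
  have B: "B \<ge> 0" by (simp add: B_def)
  define A where "A = (\<Sum>j<w. \<Sum>i\<in>{1..<j}. (1 - p ^ i))"
  define S where "S = (\<Sum>I | I \<subseteq> {..<w} \<and> card I = 2. lead_prob q w I)"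
  define Z where "Z = (real w)^2 / 2 * (1 - (1 + 2 / q) / real w)"
  have q01: "0 < q" "q < 1" and pq: "1 - q = p" using p q by auto
  have S: "S \<le> q * A" "q * (A - 2 * B) \<le> S"
    using lead_prob_sum_2[of q w] q01 pq w by (auto simp: A_def S_def B_def)
  have A: "A = Z + 1 / q + p * (1 - p ^ n) / q^2"
  proof -
    define k where "k = 1 / q"
    have "Z = (real w)^2 / 2 - real w * (1 + 2 * k) / 2"
      using w unfolding Z_def by (simp add: right_diff_distrib power2_eq_square k_def)
    also have "\<dots> = real n * (real n + 1) / 2 - (real n + 1) * k"
      by (simp add: n power2_eq_square algebra_simps add_divide_distrib)
    finally have Z: "Z = real n * (real n + 1) / 2 - (real n + 1) * k" .
    have "p / q = k - 1" using q01 q by (simp add: k_def field_simps)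
    then have "real n * p / q = real n * (k - 1)" by (metis times_divide_eq_right)
    then have "real n * (real n - 1) / 2 - real n * p / q = Z + k"
      unfolding Z by (simp add: algebra_simps add_divide_distrib diff_divide_distrib)
    then show ?thesis unfolding A_def n using sum_sum_one_minus_power[of p n] p
      by (simp add: q[symmetric] k_def)
  qed
  have "0 \<le> p * (1 - p ^ n) / q^2" using p by (simp add: power_le_one)
  moreover have "p * (1 - p ^ n) / q^2 \<le> 1 / q^2"
    using p by (intro divide_right_mono mult_le_one) (auto simp: power_le_one)
  moreover have "1 / q \<le> 1 / q^2"
    using q01 power_decreasing[of 1 2 q] by (intro divide_left_mono) auto
  moreover have "0 \<le> 1 / q" using q01 by simp
  ultimately have AZ: "0 \<le> A - Z" "A - Z \<le> 2 / q^2" using A by linarith+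
  have SZ: "\<bar>S - q * Z\<bar> \<le> q * (2 / q^2 + 2 * B)"
  proof -
    have "S - q * Z \<le> q * (A - Z)" "q * (A - Z) - q * (2 * B) \<le> S - q * Z"
      using S by (simp_all add: algebra_simps)
    moreover have "0 \<le> q * (A - Z)" "q * (A - Z) \<le> q * (2 / q^2)"
      using AZ(1) q01 mult_left_mono[OF AZ(2), of q] by simp_all
    moreover have "0 \<le> q * (2 * B)" "0 \<le> q * (2 / q^2)" using q01 B by auto
    ultimately show ?thesis unfolding distrib_left by linarith
  qed
  have "first_prob q 2 w (2 * w - 1) = q^2 * p ^ (w - 2) * S"
    using first_prob_eq_sum[of q w 2] q01 pq w by (simp add: S_def)
  then have "first_prob q 2 w (2 * w - 1) - q^3 * p ^ (w - 2) * Z = q^2 * p ^ (w - 2) * (S - q * Z)"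
    by (simp add: algebra_simps power2_eq_square power3_eq_cube)
  then have "\<bar>first_prob q 2 w (2 * w - 1) - q^3 * p ^ (w - 2) * Z\<bar> = q^2 * p ^ (w - 2) * \<bar>S - q * Z\<bar>"
    using p by (simp add: abs_mult)
  also have "\<dots> \<le> q^2 * p ^ (w - 2) * (q * (2 / q^2 + 2 * B))"
    using p SZ by (intro mult_left_mono) auto
  also have "\<dots> = (4 / q^2 + 4 * B) * (q^3 * p ^ (w - 2) * ((real w)^2 / 2)) / (real w)^2"
  proof -
    have "c * (x * (W / 2)) / W = c * x / 2" if "W \<noteq> 0" for c x W :: real using that by simp
    then have "(4 / q^2 + 4 * B) * (q^3 * p ^ (w - 2) * ((real w)^2 / 2)) / (real w)^2 =
        (4 / q^2 + 4 * B) * (q^3 * p ^ (w - 2)) / 2" using w by simp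
    also have "\<dots> = q^2 * p ^ (w - 2) * (q * (2 / q^2 + 2 * B))"
      by (simp add: power2_eq_square power3_eq_cube algebra_simps)
    finally show ?thesis by simp
  qed
  finally show ?thesis unfolding Z_def B_def by (simp add: mult.assoc)
qed

text \<open>The constant \<open>s\<close> is \<open>T / q + T * (T - 1) / 2\<close>, that is
  \<open>1 / q\<close> for one tail and \<open>1 + 2 / q\<close> for two; this is the origin of
  \<open>q\<^sub>0\<close> in the centering.\<close>

lemma first_prob_asymp:
  assumes T: "T = 1 \<or> T = 2" and p: "0 < p" "p < 1"
  defines "q \<equiv> 1 - p"
  defines "s \<equiv> real T / (2 * q / (2 + real T * q - q))"
  defines "\<Lambda> \<equiv> \<lambda>w. q ^ (T + 1) * p ^ (w - T) * (real w ^ T / fact T)"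
  shows "\<exists>K. \<forall>w\<ge>2. \<bar>first_prob q T w (2 * w - 1) - \<Lambda> w * (1 - s / real w)\<bar> \<le> K * \<Lambda> w / (real w)^2"
  using T
proof
  assume T1: "T = 1"
  have "q > 0" using p by (simp add: q_def)
  then have s: "s = 1 / q" by (simp add: s_def T1)
  have L: "\<Lambda> w = q^2 * p ^ (w - 1) * real w" for w
    by (simp add: \<Lambda>_def T1 power2_eq_square)
  show ?thesis
    using first_prob_asymp_1[OF p] unfolding s L T1 q_def by (intro exI[of _ "1 / (1 - p)^3"] allI impI) simp
next
  assume T2: "T = 2"
  have "q > 0" using p by (simp add: q_def)
  then have s: "s = 1 + 2 / q" by (simp add: s_def T2 field_simps)
  have L: "\<Lambda> w = q^3 * p ^ (w - 2) * ((real w)^2 / 2)" for w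
    by (simp add: \<Lambda>_def T2 fact_numeral)
  show ?thesis
    using first_prob_asymp_2[OF p, of q] unfolding s L T2 q_def by blast
qed

section \<open>From random variables to toss lists\<close>

text \<open>Every nonzero value is read as heads, which is harmless because the variables are almost
  surely 0 or 1.\<close>

definition toss_list :: "nat \<Rightarrow> (nat \<Rightarrow> real) \<Rightarrow> bool list" where
  "toss_list N x = map (\<lambda>i. x i = 0) [1..<Suc N]"

lemma length_toss_list [simp]: "length (toss_list N x) = N"
  by (simp add: toss_list_def)

lemma count_window_toss_list:
  assumes "i + w \<le> N"
  shows "count_list (take w (drop i (toss_list N x))) True = card {j \<in> {Suc i..<Suc i + w}. x j = 0}"
proof -
  have "take w (drop i (toss_list N x)) = map (\<lambda>j. x j = 0) [Suc i..<Suc i + w]"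
    using assms by (simp add: toss_list_def drop_map take_map del: upt_Suc)
  moreover have "count_list (map (\<lambda>j. x j = 0) xs) True = length (filter (\<lambda>j. x j = 0) xs)" for xs
    by (induction xs) auto
  ultimately show ?thesis
    by (simp add: distinct_length_filter Int_def conj_commute del: upt_Suc)
qed

text \<open>A run of length at least \<open>w\<close> contains a window of \<open>w\<close> tosses
  with at most \<open>T\<close> zeros. Conversely, such a window grows into a run with exactly
  \<open>T\<close> zeros, because one more toss adds at most one zero; this fails only if the whole
  sequence has too few zeros. Since \<open>w \<ge> 1\<close>, the inserted 0 does not
  interfere.\<close>

lemma longest_run_less_iff:
  assumes x: "\<And>i. i \<in> {1..N} \<Longrightarrow> x i = 0 \<or> x i = 1" and w: "w \<ge> 1"
  shows "longest_run T N x < w \<longleftrightarrow> avoids T w (toss_list N x) \<or> count_list (toss_list N x) True < T"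
proof -
  let ?z = "\<lambda>a m. card {j \<in> {a..<a + m}. x j = 0}"
  have mono: "?z a m \<le> ?z b n" if "b \<le> a" "a + m \<le> b + n" for a m b n
    using that by (intro card_mono) auto
  have run: "contaminated_run T N x n m \<longleftrightarrow> 1 \<le> n \<and> n + m \<le> Suc N \<and> ?z n m = T" for n m
  proof -
    have "x i = 1" if "1 \<le> n" "n + m - 1 \<le> N" "i \<in> {n..<n+m}" "x i \<noteq> 0" for i
      using x[of i] that by auto
    then show ?thesis unfolding contaminated_run_def by auto
  qed
  have fin: "finite {m. \<exists>n. contaminated_run T N x n m}"
    by (rule finite_subset[of _ "{..Suc N}"]) (auto simp: run)
  have lr: "longest_run T N x < w \<longleftrightarrow> \<not> (\<exists>n m. contaminated_run T N x n m \<and> w \<le> m)"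
    using w fin unfolding longest_run_def by (auto simp: not_le not_less)
  have total: "count_list (toss_list N x) True = ?z 1 N"
    using count_window_toss_list[of 0 N N x] by simp
  have av: "avoids T w (toss_list N x) \<longleftrightarrow> (\<forall>n. 1 \<le> n \<and> n + w \<le> Suc N \<longrightarrow> T < ?z n w)"
  proof -
    have "avoids T w (toss_list N x) \<longleftrightarrow> (\<forall>i. i + w \<le> N \<longrightarrow> T < ?z (Suc i) w)"
      unfolding avoids_def using count_window_toss_list[of _ w N x] by auto
    also have "\<dots> \<longleftrightarrow> (\<forall>n. 1 \<le> n \<and> n + w \<le> Suc N \<longrightarrow> T < ?z n w)"
    proof (intro iffI allI impI)
      fix n assume A: "\<forall>i. i + w \<le> N \<longrightarrow> T < ?z (Suc i) w" and n: "1 \<le> n \<and> n + w \<le> Suc N"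
      then obtain i where "n = Suc i" by (cases n) auto
      with A n show "T < ?z n w" by simp
    next
      fix i assume A: "\<forall>n. 1 \<le> n \<and> n + w \<le> Suc N \<longrightarrow> T < ?z n w" and i: "i + w \<le> N"
      show "T < ?z (Suc i) w" using A[rule_format, of "Suc i"] i by simp
    qed
    finally show ?thesis .
  qed
  show ?thesis
  proof
    assume L: "longest_run T N x < w"
    show "avoids T w (toss_list N x) \<or> count_list (toss_list N x) True < T"
    proof (rule ccontr)
      assume neg: "\<not> ?thesis"
      then have "\<not> (\<forall>n. 1 \<le> n \<and> n + w \<le> Suc N \<longrightarrow> T < ?z n w)" using av by blast
      then obtain n where n: "1 \<le> n" "n + w \<le> Suc N" "?z n w \<le> T" by (meson not_less)
      have tot: "T \<le> ?z 1 N" using neg total by simp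
      \<comment> \<open>A longest block with at most \<open>T\<close> zeros is chosen; with fewer
        than \<open>T\<close> it could be extended to the right or to the left, unless it is the
        whole sequence.\<close>
      define S where "S = {(a, m). 1 \<le> a \<and> a + m \<le> Suc N \<and> w \<le> m \<and> ?z a m \<le> T}"
      have "finite S" by (rule finite_subset[of _ "{..Suc N} \<times> {..Suc N}"]) (auto simp: S_def)
      moreover have "(n, w) \<in> S" using n by (simp add: S_def)
      ultimately have "Max (snd ` S) \<in> snd ` S" and max': "\<forall>z\<in>S. snd z \<le> Max (snd ` S)"
        by (auto intro!: Max_in)
      then obtain a m where am: "(a, m) \<in> S" and "m = Max (snd ` S)" by auto
      with max' have max: "\<And>a' m'. (a', m') \<in> S \<Longrightarrow> m' \<le> m" by auto
      have "?z a m = T"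
      proof (rule ccontr)
        assume "?z a m \<noteq> T"
        then have lt: "?z a m < T" using am by (simp add: S_def)
        show False
        proof (cases "a + m \<le> N")
          case True
          have "{j \<in> {a..<a + Suc m}. x j = 0} \<subseteq> insert (a + m) {j \<in> {a..<a + m}. x j = 0}" by auto
          then have "?z a (Suc m) \<le> card (insert (a + m) {j \<in> {a..<a + m}. x j = 0})"
            by (intro card_mono) auto
          also have "\<dots> \<le> Suc (?z a m)" by (rule card_insert_le_m1) auto
          finally have "(a, Suc m) \<in> S" using am lt True by (auto simp: S_def)
          then show False using max by fastforce
        next
          case False
          show False
          proof (cases "a = 1")
            case True
            with False am have "m = N" by (auto simp: S_def)
            with True lt tot show False by simp
          next
            case F2: False
            then obtain b where b: "a = Suc b" "1 \<le> b" using am by (cases a) (auto simp: S_def)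
            have "{j \<in> {b..<b + Suc m}. x j = 0} \<subseteq> insert b {j \<in> {a..<a + m}. x j = 0}"
              using b by auto
            then have "?z b (Suc m) \<le> card (insert b {j \<in> {a..<a + m}. x j = 0})"
              by (intro card_mono) auto
            also have "\<dots> \<le> Suc (?z a m)" by (rule card_insert_le_m1) auto
            finally have "(b, Suc m) \<in> S" using am lt b by (auto simp: S_def)
            then show False using max by fastforce
          qed
        qed
      qed
      with am have "contaminated_run T N x a m" "w \<le> m" by (auto simp: run S_def)
      with L lr show False by blast
    qed
  next
    assume R: "avoids T w (toss_list N x) \<or> count_list (toss_list N x) True < T"
    show "longest_run T N x < w"
      unfolding lr
    proof
      assume "\<exists>n m. contaminated_run T N x n m \<and> w \<le> m"
      then obtain n m where nm: "1 \<le> n" "n + m \<le> Suc N" "?z n m = T" "w \<le> m" by (auto simp: run)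
      have "?z n w \<le> T" using mono[of n n w m] nm by simp
      moreover have "T \<le> ?z 1 N" using mono[of 1 n m N] nm by simp
      moreover have "n + w \<le> Suc N" using nm by linarith
      ultimately show False using R unfolding av total using nm(1) by fastforce
    qed
  qed
qed

text \<open>Up to a null set the events \<open>A bs\<close> of fixed 0-1 patterns partition the
  space, and by independence they have the weights of \<open>tosses\<close>. Hence \<open>P\<close>
  and \<open>Q\<close> have to agree on 0-1 sequences only.\<close>

lemma (in prob_space) prob_toss_sequence:
  fixes Y :: "nat \<Rightarrow> 'a \<Rightarrow> real" and P :: "(nat \<Rightarrow> real) \<Rightarrow> bool"
  assumes p: "0 \<le> p" "p \<le> 1"
    and indep: "indep_vars (\<lambda>_. borel) Y {1..N}"
    and heads: "\<And>i. i \<in> {1..N} \<Longrightarrow> prob {\<omega> \<in> space M. Y i \<omega> = 1} = p"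
    and tails: "\<And>i. i \<in> {1..N} \<Longrightarrow> prob {\<omega> \<in> space M. Y i \<omega> = 0} = 1 - p"
    and meas: "{\<omega> \<in> space M. P (\<lambda>i. Y i \<omega>)} \<in> events"
    and P: "\<And>x. (\<And>i. i \<in> {1..N} \<Longrightarrow> x i = 0 \<or> x i = 1) \<Longrightarrow> P x \<longleftrightarrow> Q (toss_list N x)"
  shows "prob {\<omega> \<in> space M. P (\<lambda>i. Y i \<omega>)} = measure_pmf.prob (tosses (1 - p) N) {xs. Q xs}"
proof -
  have rv: "random_variable borel (Y i)" if "i \<in> {1..N}" for i
    using indep that unfolding indep_vars_def by auto
  define h where "h b = (if b then 0 else 1 :: real)" for b
  have atom: "prob {\<omega> \<in> space M. \<forall>i\<in>{1..N}. Y i \<omega> = h (bs ! (i - 1))} = pmf (tosses (1 - p) N) bs"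
    if "length bs = N" for bs
  proof (cases "N = 0")
    \<comment> \<open>The empty pattern is treated apart, since the product rule used below is for
      nonempty index sets.\<close>
    case True
    with that show ?thesis by (simp add: tosses_def prob_space)
  next
    case False
    have "{\<omega> \<in> space M. \<forall>i\<in>{1..N}. Y i \<omega> = h (bs ! (i - 1))} =
        (\<Inter>i\<in>{1..N}. Y i -` {h (bs ! (i - 1))} \<inter> space M)" using False by auto
    also have "prob \<dots> = (\<Prod>i\<in>{1..N}. prob (Y i -` {h (bs ! (i - 1))} \<inter> space M))"
      using False by (intro indep_varsD_finite[OF indep]) auto
    also have "\<dots> = (\<Prod>i\<in>{1..N}. if bs ! (i - 1) then 1 - p else p)"
      using heads tails by (intro prod.cong) (auto simp: h_def vimage_def Int_def conj_commute)
    also have "\<dots> = (\<Prod>i<N. if bs ! i then 1 - p else 1 - (1 - p))"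
      by (rule prod.reindex_bij_witness[of _ Suc "\<lambda>i. i - 1"]) auto
    also have "\<dots> = pmf (tosses (1 - p) N) bs"
      using pmf_tosses[of "1 - p" bs] p that by simp
    finally show ?thesis .
  qed
  let ?A = "{\<omega> \<in> space M. P (\<lambda>i. Y i \<omega>)}"
  have ae: "AE \<omega> in M. \<forall>i\<in>{1..N}. Y i \<omega> = 0 \<or> Y i \<omega> = 1"
  proof (rule AE_finite_allI)
    fix i assume i: "i \<in> {1..N}"
    have [measurable]: "Y i \<in> borel_measurable M" using rv[OF i] .
    have "prob ({\<omega> \<in> space M. Y i \<omega> = 0} \<union> {\<omega> \<in> space M. Y i \<omega> = 1}) =
        prob {\<omega> \<in> space M. Y i \<omega> = 0} + prob {\<omega> \<in> space M. Y i \<omega> = 1}"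
      by (intro finite_measure_Union) auto
    then have "prob {\<omega> \<in> space M. Y i \<omega> = 0 \<or> Y i \<omega> = 1} = 1"
      using heads[OF i] tails[OF i] by (simp add: Collect_disj_eq[symmetric] conj_disj_distribL[symmetric])
    then show "AE \<omega> in M. Y i \<omega> = 0 \<or> Y i \<omega> = 1"
      by (subst (asm) prob_Collect_eq_1) auto
  qed simp
  define A where "A bs = {\<omega> \<in> space M. \<forall>i\<in>{1..N}. Y i \<omega> = h (bs ! (i - 1))}" for bs
  have mA: "A bs \<in> events" for bs
  proof -
    have "{\<omega> \<in> space M. Y i \<omega> = h (bs ! (i - 1))} \<in> events" if "i \<in> {1..N}" for i
      using rv[OF that] by measurable
    then show ?thesis unfolding A_def by (intro sets.sets_Collect_finite_All) auto
  qed
  let ?L = "{bs. length bs = N \<and> Q bs}"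
  have finL: "finite ?L"
    by (rule finite_subset[OF _ finite_lists_length_eq[of UNIV N]]) auto
  have list: "toss_list N (\<lambda>i. Y i \<omega>) = bs" if "\<omega> \<in> A bs" "length bs = N" for \<omega> bs
    using that by (intro nth_equalityI) (auto simp: A_def toss_list_def h_def simp del: upt_Suc split: if_splits)
  have "prob ?A = prob (\<Union>bs\<in>?L. A bs)"
  proof (rule finite_measure_eq_AE)
    show "AE \<omega> in M. \<omega> \<in> ?A \<longleftrightarrow> \<omega> \<in> (\<Union>bs\<in>?L. A bs)"
      using ae AE_space
    proof eventually_elim
      case (elim \<omega>)
      have in_A: "\<omega> \<in> A (toss_list N (\<lambda>i. Y i \<omega>))"
        using elim by (force simp: A_def toss_list_def h_def simp del: upt_Suc)
      have "\<omega> \<in> ?A \<longleftrightarrow> Q (toss_list N (\<lambda>i. Y i \<omega>))"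
        using P[of "\<lambda>i. Y i \<omega>"] elim by simp
      also have "\<dots> \<longleftrightarrow> \<omega> \<in> (\<Union>bs\<in>?L. A bs)"
      proof
        assume "Q (toss_list N (\<lambda>i. Y i \<omega>))"
        with in_A show "\<omega> \<in> (\<Union>bs\<in>?L. A bs)" by (intro UN_I[of "toss_list N (\<lambda>i. Y i \<omega>)"]) simp_all
      next
        assume "\<omega> \<in> (\<Union>bs\<in>?L. A bs)"
        then obtain bs where "bs \<in> ?L" "\<omega> \<in> A bs" by (rule UN_E)
        with list[of \<omega> bs] show "Q (toss_list N (\<lambda>i. Y i \<omega>))" by simp
      qed
      finally show ?case .
    qed
  qed (use mA finL meas in auto)
  also have "\<dots> = (\<Sum>bs\<in>?L. prob (A bs))"
  proof (intro finite_measure_finite_Union finL)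
    show "disjoint_family_on A ?L"
      unfolding disjoint_family_on_def
    proof (intro ballI impI equals0I)
      fix bs bs' \<omega> assume "bs \<in> ?L" "bs' \<in> ?L" "bs \<noteq> bs'" "\<omega> \<in> A bs \<inter> A bs'"
      then show False using list[of \<omega> bs] list[of \<omega> bs'] by simp
    qed
  qed (use mA in auto)
  also have "\<dots> = (\<Sum>bs\<in>?L. pmf (tosses (1 - p) N) bs)"
    using atom by (intro sum.cong) (auto simp: A_def)
  also have "\<dots> = measure_pmf.prob (tosses (1 - p) N) ?L"
    using finL by (simp add: measure_measure_pmf_finite)
  also have "\<dots> = measure_pmf.prob (tosses (1 - p) N) {xs. Q xs}"
    by (intro prob_tosses_cong) auto
  finally show ?thesis .
qed

section \<open>Measurability of the longest run and comparison with toss lists\<close>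

lemma longest_run_cong:
  assumes "\<And>i. i \<in> {1..N} \<Longrightarrow> (x i = 0 \<longleftrightarrow> y i = 0) \<and> (x i = 1 \<longleftrightarrow> y i = 1)"
  shows "longest_run T N x = longest_run T N y"
proof -
  have "contaminated_run T N x n m \<longleftrightarrow> contaminated_run T N y n m" for n m
  proof (cases "1 \<le> n \<and> n + m - 1 \<le> N")
    case True
    then have "i \<in> {1..N}" if "i \<in> {n..<n+m}" for i using that by auto
    with assms have e: "(x i = 0 \<longleftrightarrow> y i = 0) \<and> (x i = 1 \<longleftrightarrow> y i = 1)" if "i \<in> {n..<n+m}" for i
      using that by blast
    then have "{i \<in> {n..<n + m}. x i = 0} = {i \<in> {n..<n + m}. y i = 0}" by blast
    with e show ?thesis unfolding contaminated_run_def by auto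
  qed (auto simp: contaminated_run_def)
  then show ?thesis by (simp add: longest_run_def)
qed

text \<open>Only equality with 0 and with 1 is ever tested, so each variable may be collapsed by
  \<open>g\<close> to three values, 2 standing for all others. The collapsed sequence has finite
  range, and any function of it is measurable.\<close>

lemma measurable_longest_run:
  assumes "\<And>i. i \<in> {1..N} \<Longrightarrow> Y i \<in> borel_measurable M"
  shows "(\<lambda>\<omega>. longest_run T N (\<lambda>i. Y i \<omega>)) \<in> measurable M (count_space UNIV)"
proof -
  define g where "g r = (if r = 0 then 0 else if r = 1 then 1 else 2 :: real)" for r :: real
  have g: "g \<in> borel_measurable borel" unfolding g_def by measurable
  define V where "V \<omega> = restrict (\<lambda>i. g (Y i \<omega>)) {1..N}" for \<omega>
  let ?F = "{1..N} \<rightarrow>\<^sub>E {0, 1, 2 :: real}"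
  have fin: "finite ?F" by (intro finite_PiE) auto
  have "V \<in> measurable M (count_space ?F)"
  proof (subst measurable_count_space_eq2, rule fin, intro conjI ballI)
    show "V \<in> space M \<rightarrow> ?F" by (auto simp: V_def g_def)
    fix v assume v: "v \<in> ?F"
    have "{\<omega> \<in> space M. g (Y i \<omega>) = v i} \<in> sets M" if "i \<in> {1..N}" for i
      using measurable_compose[OF assms[OF that] g] by measurable
    then have "{\<omega> \<in> space M. \<forall>i\<in>{1..N}. g (Y i \<omega>) = v i} \<in> sets M"
      by (intro sets.sets_Collect_finite_All) auto
    moreover have "V -` {v} \<inter> space M = {\<omega> \<in> space M. \<forall>i\<in>{1..N}. g (Y i \<omega>) = v i}"
      using v by (auto simp: V_def fun_eq_iff PiE_def extensional_def restrict_def)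
    ultimately show "V -` {v} \<inter> space M \<in> sets M" by simp
  qed
  then have "(\<lambda>\<omega>. longest_run T N (V \<omega>)) \<in> measurable M (count_space UNIV)"
    by (rule measurable_compose) simp
  moreover have "longest_run T N (V \<omega>) = longest_run T N (\<lambda>i. Y i \<omega>)" for \<omega>
    by (rule longest_run_cong) (auto simp: V_def g_def)
  ultimately show ?thesis by simp
qed

text \<open>The two events differ only if there are fewer than \<open>T\<close> tails in all, and
  then the first \<open>w\<close> tosses have at most \<open>T\<close> tails.\<close>

lemma (in prob_space) prob_longest_run_approx:
  fixes Y :: "nat \<Rightarrow> 'a \<Rightarrow> real"
  assumes p: "0 \<le> p" "p \<le> 1"
    and indep: "indep_vars (\<lambda>_. borel) Y {1..N}"
    and heads: "\<And>i. i \<in> {1..N} \<Longrightarrow> prob {\<omega> \<in> space M. Y i \<omega> = 1} = p"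
    and tails: "\<And>i. i \<in> {1..N} \<Longrightarrow> prob {\<omega> \<in> space M. Y i \<omega> = 0} = 1 - p"
    and w: "1 \<le> w" "w \<le> N"
  shows "\<bar>prob {\<omega> \<in> space M. longest_run T N (\<lambda>i. Y i \<omega>) < w} - avoid_prob (1 - p) T w N\<bar>
           \<le> few_prob (1 - p) T w"
proof -
  let ?pr = "measure_pmf.prob (tosses (1 - p) N)"
  have rv: "random_variable borel (Y i)" if "i \<in> {1..N}" for i
    using indep that unfolding indep_vars_def by auto
  have "{\<omega> \<in> space M. longest_run T N (\<lambda>i. Y i \<omega>) < w} \<in> events"
    using measurable_longest_run[of N Y M T] rv by measurable
  then have "prob {\<omega> \<in> space M. longest_run T N (\<lambda>i. Y i \<omega>) < w} =
      ?pr {xs. avoids T w xs \<or> count_list xs True < T}" (is "?P = _")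
    by (intro prob_toss_sequence[OF p indep heads tails] longest_run_less_iff w) auto
  also have "{xs. avoids T w xs \<or> count_list xs True < T} = {xs. avoids T w xs} \<union> {xs. count_list xs True < T}"
    by auto
  finally have P: "?P = ?pr ({xs. avoids T w xs} \<union> {xs. count_list xs True < T})" .
  have "?P \<ge> avoid_prob (1 - p) T w N"
    unfolding P avoid_prob_def by (intro measure_pmf.finite_measure_mono) auto
  moreover have "?P \<le> avoid_prob (1 - p) T w N + ?pr {xs. count_list xs True < T}"
    unfolding P avoid_prob_def by (rule measure_Un_le) auto
  moreover have "?pr {xs. count_list xs True < T} \<le> few_prob (1 - p) T w"
  proof -
    obtain s where s: "N = w + s" using w by (auto simp: le_iff_add)
    have "?pr {xs. count_list xs True < T} \<le> ?pr {xs. count_list (take w xs) True \<le> T}"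
    proof (rule prob_tosses_mono)
      fix xs :: "bool list" assume "count_list xs True < T"
      then show "count_list (take w xs) True \<le> T"
        using count_list_append[of "take w xs" "drop w xs" True] by simp
    qed
    also have "\<dots> = few_prob (1 - p) T w" unfolding s few_prob_def by (rule prob_tosses_take)
    finally show ?thesis .
  qed
  ultimately show ?thesis by linarith
qed

section \<open>Asymptotics of the centering\<close>

text \<open>The centering of the theorem as a function of \<open>L = log (1/p) (q N)\<close>, with \<open>a = 1/c\<close>,
  \<open>K = T log (q/p) - log (T!)\<close> and \<open>d = T/q\<^sub>0\<close>; it solves \<open>m = L + K + T log m - d/(c m)\<close> up to
  \<open>O(1/L\<^sup>2)\<close>.\<close>

definition centering :: "real \<Rightarrow> real \<Rightarrow> real \<Rightarrow> real \<Rightarrow> real \<Rightarrow> real" where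
  "centering a t K d L = L + (t * a * ln L + K) + (t^2 * a^2 * ln L - d * a + K * t * a) / L +
     (- (t^3 * a^3 / 2) * (ln L)^2 + (t * d * a^2 + t^3 * a^3 - K * t^2 * a^2) * ln L) / L^2"

text \<open>The filter \<open>at 0\<close> says nothing about 0 itself, a value that
  \<open>x\<close> may take; \<open>f 0 = 0\<close> closes this gap.\<close>

lemma bigo_compose_at_0:
  fixes f :: "real \<Rightarrow> real" and x :: "'b \<Rightarrow> real"
  assumes "f \<in> O[at 0](\<lambda>x. x ^ n)" "f 0 = 0" "(x \<longlongrightarrow> 0) F"
  shows "(\<lambda>L. f (x L)) \<in> O[F](\<lambda>L. x L ^ n)"
proof -
  obtain C where C: "C > 0" "\<forall>\<^sub>F y in at 0. norm (f y) \<le> C * norm (y ^ n)"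
    using assms(1) by (elim landau_o.bigE)
  then have "\<forall>\<^sub>F y in nhds 0. norm (f y) \<le> C * norm (y ^ n)"
    using assms(2) unfolding eventually_at_filter by (auto elim!: eventually_mono)
  then have "\<forall>\<^sub>F L in F. norm (f (x L)) \<le> C * norm (x L ^ n)"
    using assms(3) by (rule eventually_compose_filterlim)
  then show ?thesis by (rule bigoI)
qed

text \<open>With \<open>m L = L * (1 + x L)\<close>, expand \<open>ln (1 + x)\<close> to second and
  \<open>1 / (1 + x)\<close> to first order and compare coefficients of powers of
  \<open>1 / L\<close>. The coefficients of the centering are the ones that make them
  cancel.\<close>

lemma centering_asymp:
  fixes a t K d :: real
  defines "m \<equiv> centering a t K d"
  shows centering_asymp_fixpoint:
      "(\<lambda>L. L + K - m L + t * a * ln (m L) - d * a / m L) \<in> O(\<lambda>L. 1 / L^2)"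
    and centering_asymp_inverse: "(\<lambda>L. 1 / m L - 1 / L + t * a * ln L / L^2) \<in> O(\<lambda>L. 1 / L^2)"
    and centering_asymp_equiv: "((\<lambda>L. m L / L) \<longlongrightarrow> 1) at_top"
proof -
  define A where "A L = t * a * ln L + K" for L
  define B where "B L = t^2 * a^2 * ln L - d * a + K * t * a" for L
  define C where "C L = - (t^3 * a^3 / 2) * (ln L)^2 + (t * d * a^2 + t^3 * a^3 - K * t^2 * a^2) * ln L" for L
  define x where "x L = A L / L + B L / L^2 + C L / L^3" for L
  \<comment> \<open>This is the part without \<open>ln L\<close> in the coefficient of
    \<open>1 / L^2\<close>. The centering does not compensate it, as it is already
    \<open>O(1 / L^2)\<close>.\<close>
  define \<kappa> where "\<kappa> = t * a * (K * t * a - d * a) - t * a / 2 * K^2 + d * a * K"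
  let ?P = "\<lambda>L::real. (ln L)^2"
  have nz: "\<forall>\<^sub>F L::real in at_top. L \<noteq> 0" using eventually_gt_at_top[of 0] by eventually_elim auto
  have nzp: "\<forall>\<^sub>F L::real in at_top. L ^ j \<noteq> 0" for j :: nat using nz by eventually_elim simp
  have ln: "(\<lambda>L::real. ln L) \<in> O(?P)" and one: "(\<lambda>L::real. c) \<in> O(?P)" for c :: real
    by real_asymp+
  have A: "A \<in> O(?P)" and B: "B \<in> O(?P)" and C: "C \<in> O(?P)"
    unfolding A_def B_def C_def using ln one by (intro sum_in_bigo; simp)+
  \<comment> \<open>From the third order on, any power of \<open>ln L\<close> is absorbed.\<close>
  have div: "(\<lambda>L. f L / L ^ j) \<in> O(\<lambda>L. 1 / L^2)" if "f \<in> O(\<lambda>L. (ln L) ^ i)" "j \<ge> 3" for f :: "real \<Rightarrow> real" and i j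
  proof -
    have "(\<lambda>L. f L / L ^ j) \<in> O(\<lambda>L. (ln L) ^ i / L ^ j)"
      by (rule landau_o.big.divide_right[OF nzp that(1)])
    also have "(\<lambda>L::real. (ln L) ^ i / L ^ j) \<in> O(\<lambda>L. (ln L) ^ i / L ^ 3)"
    proof (rule landau_o.big_mono)
      show "\<forall>\<^sub>F L::real in at_top. norm ((ln L) ^ i / L ^ j) \<le> norm ((ln L) ^ i / L ^ 3)"
        using eventually_ge_at_top[of 1]
      proof eventually_elim
        case (elim L)
        then have "L ^ 3 \<le> L ^ j" using that by (intro power_increasing) auto
        with elim show ?case by (auto intro!: divide_left_mono)
      qed
    qed
    also have "(\<lambda>L::real. (ln L) ^ i / L ^ 3) \<in> O(\<lambda>L. 1 / L^2)" by real_asymp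
    finally show ?thesis .
  qed
  have mult: "(\<lambda>L. f L * g L) \<in> O(\<lambda>L. (ln L) ^ 4)" if "f \<in> O(?P)" "g \<in> O(?P)" for f g :: "real \<Rightarrow> real"
    using landau_o.big.mult[OF that] by (simp add: power4_eq_xxxx power2_eq_square mult.assoc)
  have scale: "(\<lambda>L. c * f L) \<in> O(h)" if "f \<in> O(h)" for c and f h :: "real \<Rightarrow> real"
    using that by (cases "c = 0") simp_all
  have up: "f \<in> O(\<lambda>L. (ln L) ^ 4)" if "f \<in> O(?P)" for f :: "real \<Rightarrow> real"
  proof -
    have "?P \<in> O(\<lambda>L. (ln L) ^ 4)" by real_asymp
    with that show ?thesis by (rule landau_o.big_trans)
  qed
  have x: "x \<in> O(\<lambda>L. (ln L)^2 / L)"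
  proof -
    have "(\<lambda>L. f L / L ^ j) \<in> O(\<lambda>L. ?P L / L)" if "f \<in> O(?P)" "j \<ge> 1" for f :: "real \<Rightarrow> real" and j
    proof -
      have "(\<lambda>L. f L / L ^ j) \<in> O(\<lambda>L. ?P L / L ^ j)"
        by (rule landau_o.big.divide_right[OF nzp that(1)])
      also have "(\<lambda>L::real. ?P L / L ^ j) \<in> O(\<lambda>L. ?P L / L)"
      proof (rule landau_o.big_mono)
        show "\<forall>\<^sub>F L::real in at_top. norm (?P L / L ^ j) \<le> norm (?P L / L)"
          using eventually_ge_at_top[of 1]
        proof eventually_elim
          case (elim L)
          then have "L ^ 1 \<le> L ^ j" using that by (intro power_increasing) auto
          with elim show ?case by (auto intro!: divide_left_mono)
        qed
      qed
      finally show ?thesis .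
    qed
    from this[OF A, of 1] this[OF B, of 2] this[OF C, of 3] show ?thesis
      unfolding x_def by (intro sum_in_bigo) auto
  qed
  have x0: "(x \<longlongrightarrow> 0) at_top"
  proof -
    have "(\<lambda>L::real. (ln L)^2 / L) \<in> o(\<lambda>_. 1)" by real_asymp
    with x have "x \<in> o(\<lambda>_. 1)" by (rule landau_o.big_small_trans)
    then show ?thesis by (auto dest: smalloD_tendsto)
  qed
  have xpow: "(\<lambda>L. x L ^ n) \<in> O(\<lambda>L. (ln L) ^ (2 * n) / L ^ n)" for n
    using landau_o.big_power[OF x, of n] by (simp add: power_divide power_mult)
  \<comment> \<open>Taylor remainders of orders 3 and 2; the second will be divided by
    \<open>L\<close>, so both become \<open>O(1 / L^2)\<close>.\<close>
  define r1 where "r1 L = ln (1 + x L) - x L + (x L)^2 / 2" for L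
  define r2 where "r2 L = 1 / (1 + x L) - 1 + x L" for L
  have "(\<lambda>x::real. ln (1 + x) - x + x^2 / 2) \<in> O[at 0](\<lambda>x. x ^ 3)" by real_asymp
  then have "r1 \<in> O(\<lambda>L. x L ^ 3)" unfolding r1_def by (rule bigo_compose_at_0) (use x0 in auto)
  also note xpow
  also have "(\<lambda>L::real. (ln L) ^ (2 * 3) / L ^ 3) \<in> O(\<lambda>L. 1 / L^2)" by real_asymp
  finally have r1: "r1 \<in> O(\<lambda>L. 1 / L^2)" .
  have "(\<lambda>x::real. 1 / (1 + x) - 1 + x) \<in> O[at 0](\<lambda>x. x ^ 2)" by real_asymp
  then have "r2 \<in> O(\<lambda>L. x L ^ 2)" unfolding r2_def by (rule bigo_compose_at_0) (use x0 in auto)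
  also note xpow
  finally have "r2 \<in> O(\<lambda>L. (ln L) ^ (2 * 2) / L ^ 2)" .
  then have "(\<lambda>L. r2 L / L) \<in> O(\<lambda>L. (ln L) ^ (2 * 2) / L ^ 2 / L)"
    by (rule landau_o.big.divide_right[OF nz])
  also have "(\<lambda>L::real. (ln L) ^ (2 * 2) / L ^ 2 / L) \<in> O(\<lambda>L. 1 / L^2)" by real_asymp
  finally have r2: "(\<lambda>L. r2 L / L) \<in> O(\<lambda>L. 1 / L^2)" .
  have m: "m L = L * (1 + x L)" if "L > 0" for L
    using that unfolding m_def centering_def x_def A_def[symmetric] B_def[symmetric] C_def[symmetric]
    by (simp add: distrib_left power2_eq_square power3_eq_cube)
  have ev: "\<forall>\<^sub>F L in at_top. L > 0 \<and> 1 + x L > 0"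
  proof -
    have "\<forall>\<^sub>F L in at_top. x L > -1" using x0 by (rule order_tendstoD) simp
    with eventually_gt_at_top[of 0] show ?thesis by eventually_elim auto
  qed
  show "((\<lambda>L. m L / L) \<longlongrightarrow> 1) at_top"
  proof (rule Lim_transform_eventually)
    show "((\<lambda>L. 1 + x L) \<longlongrightarrow> 1) at_top" using tendsto_add[OF tendsto_const x0, of 1] by simp
    show "\<forall>\<^sub>F L in at_top. 1 + x L = m L / L" using ev by eventually_elim (simp add: m)
  qed
  have const: "(\<lambda>L. c / L^2) \<in> O(\<lambda>L::real. 1 / L^2)" for c :: real by real_asymp
  have mem: "(\<lambda>L. r2 L / L - K / L^2 - B L / L^3 - C L / L^4) \<in> O(\<lambda>L. 1 / L^2)"
    by (intro sum_in_bigo r2 const div[OF B] div[OF C]) auto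
  have eq: "\<forall>\<^sub>F L in at_top. r2 L / L - K / L^2 - B L / L^3 - C L / L^4 =
      1 / m L - 1 / L + t * a * ln L / L^2"
    using ev
  proof eventually_elim
    case (elim L)
    have "r2 L / L = 1 / m L - 1 / L + x L / L"
      using elim by (simp add: r2_def m add_divide_distrib diff_divide_distrib mult.commute)
    moreover have "x L / L = A L / L^2 + B L / L^3 + C L / L^4"
      by (simp add: x_def add_divide_distrib power2_eq_square power3_eq_cube power4_eq_xxxx mult.assoc)
    moreover have "A L / L^2 = t * a * ln L / L^2 + K / L^2"
      by (simp add: A_def add_divide_distrib)
    ultimately show ?case by linarith
  qed
  show "(\<lambda>L. 1 / m L - 1 / L + t * a * ln L / L^2) \<in> O(\<lambda>L. 1 / L^2)"
    by (rule iffD1[OF landau_o.big.in_cong[OF eq] mem])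
  \<comment> \<open>All terms of the expansion that do not cancel, sorted by powers of
    \<open>1 / L\<close>.\<close>
  define R where "R L = \<kappa> / L^2 + (t * a * C L - t * a * (A L * B L) + d * a * B L) / L^3 +
      (d * a * C L - t * a / 2 * (B L * B L) - t * a * (A L * C L)) / L^4 -
      t * a * (B L * C L) / L^5 - t * a / 2 * (C L * C L) / L^6" for L
  have "R \<in> O(\<lambda>L. 1 / L^2)"
    unfolding R_def
    by (intro sum_in_bigo const div[of _ 4] scale mult up A B C) simp_all
  then have mem': "(\<lambda>L. R L + t * a * r1 L - d * a * (r2 L / L)) \<in> O(\<lambda>L. 1 / L^2)"
    by (intro sum_in_bigo scale r1 r2)
  have eq': "\<forall>\<^sub>F L in at_top. R L + t * a * r1 L - d * a * (r2 L / L) =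
      L + K - m L + t * a * ln (m L) - d * a / m L"
    using ev
  proof eventually_elim
    case (elim L)
    define v where "v = 1 / L"
    have v: "L * v = 1" using elim by (simp add: v_def)
    have xv: "x L = A L * v + B L * v^2 + C L * v^3" by (simp add: x_def v_def power_divide)
    have Rv: "R L = \<kappa> * v^2 + (t * a * C L - t * a * (A L * B L) + d * a * B L) * v^3 +
      (d * a * C L - t * a / 2 * (B L * B L) - t * a * (A L * C L)) * v^4 -
      t * a * (B L * C L) * v^5 - t * a / 2 * (C L * C L) * v^6"
      by (simp add: R_def v_def power_divide)
    \<comment> \<open>The vanishing of the coefficients of orders 0, 1 and 2 determines
      \<open>A\<close>, \<open>B\<close> and, up to \<kappa>, \<open>C\<close> one after the
      other.\<close>
    have A1: "t * a * ln L + K - A L = 0" by (simp add: A_def)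
    have B1: "t * a * A L - d * a - B L = 0"
      by (simp add: A_def B_def algebra_simps power2_eq_square)
    have C1: "t * a * B L - t * a / 2 * (A L)^2 + d * a * A L - C L - \<kappa> = 0"
      unfolding A_def B_def C_def \<kappa>_def by (simp add: field_simps power2_eq_square power3_eq_cube)
    have r2v: "r2 L / L = 1 / m L - v + x L * v"
      using elim by (simp add: r2_def m v_def add_divide_distrib diff_divide_distrib mult.commute)
    have lnm: "ln (m L) = ln L + ln (1 + x L)" using elim by (simp add: m ln_mult)
    have mv: "m L = L + A L + B L * v + C L * v^2"
    proof -
      have "m L = L + (L * v) * (A L + B L * v + C L * v^2)"
        using elim by (simp add: m xv algebra_simps power2_eq_square power3_eq_cube)
      then show ?thesis by (simp add: v)
    qed
    have "(L + K - m L + t * a * ln (m L) - d * a / m L) - (R L + t * a * r1 L - d * a * (r2 L / L)) =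
       (L + K - m L) + t * a * (ln L + x L - (x L)^2 / 2) - d * a * (v - x L * v) - R L"
      unfolding r2v r1_def lnm by (simp add: algebra_simps)
    also have "\<dots> = (t * a * ln L + K - A L) + v * (t * a * A L - d * a - B L) +
       v^2 * (t * a * B L - t * a / 2 * (A L)^2 + d * a * A L - C L - \<kappa>)"
      unfolding mv xv Rv by (simp add: field_simps eval_nat_numeral)
    also have "\<dots> = 0" unfolding A1 B1 C1 by simp
    finally show ?case by simp
  qed
  show "(\<lambda>L. L + K - m L + t * a * ln (m L) - d * a / m L) \<in> O(\<lambda>L. 1 / L^2)"
    by (rule iffD1[OF landau_o.big.in_cong[OF eq'] mem'])
qed

text \<open>To first order the shift contributes \<open>- c * \<theta> + t * \<theta> / m L\<close>,
  and \<open>centering_asymp_inverse\<close> replaces \<open>1 / m L\<close> by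
  \<open>1 / L - t * ln L / (c * L^2)\<close>: this gives the factor in the exponent of the main
  term. The quadratic term of \<open>ln\<close> is already \<open>O(1 / L^2)\<close>.\<close>

lemma centering_asymp_shift:
  fixes c t K d \<Theta> :: real
  assumes c: "c > 0" and \<Theta>: "\<Theta> \<ge> 0"
  defines "m \<equiv> centering (1 / c) t K d"
  shows "\<exists>C. \<forall>\<^sub>F L in at_top. \<forall>\<theta>. \<bar>\<theta>\<bar> \<le> \<Theta> \<longrightarrow> L / 2 \<le> m L + \<theta> \<and> m L + \<theta> \<le> 2 * L \<and>
    \<bar>c * (L + K - (m L + \<theta>)) + t * ln (m L + \<theta>) - d / (m L + \<theta>)
       + c * \<theta> * (1 - t / (c * L) + t^2 * ln L / (c^2 * L^2))\<bar> \<le> C / L^2"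
proof -
  define a where "a = 1 / c"
  have a: "c * a = 1" "a > 0" using c by (auto simp: a_def)
  have m: "m = centering a t K d" by (simp add: m_def a_def)
  define F where "F L = L + K - m L + t * a * ln (m L) - d * a / m L" for L
  define G where "G L = 1 / m L - 1 / L + t * a * ln L / L^2" for L
  have "F \<in> O(\<lambda>L. 1 / L^2)" unfolding F_def m by (rule centering_asymp)
  then obtain C1 where C1: "\<forall>\<^sub>F L in at_top. norm (F L) \<le> C1 * norm (1 / L^2)"
    by (elim landau_o.bigE)
  have "G \<in> O(\<lambda>L. 1 / L^2)" unfolding G_def m by (rule centering_asymp)
  then obtain C2 where C2: "\<forall>\<^sub>F L in at_top. norm (G L) \<le> C2 * norm (1 / L^2)"
    by (elim landau_o.bigE)
  have lim: "((\<lambda>L. m L / L) \<longlongrightarrow> 1) at_top" unfolding m by (rule centering_asymp)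
  \<comment> \<open>These margins leave room for a shift by at most \<open>L / 4\<close>, so that
    \<open>m L + \<theta>\<close> stays between \<open>L / 2\<close> and
    \<open>2 * L\<close>.\<close>
  have "\<forall>\<^sub>F L in at_top. m L / L > 3 / 4" "\<forall>\<^sub>F L in at_top. m L / L < 3 / 2"
    by (rule order_tendstoD[OF lim]; simp)+
  then have "\<forall>\<^sub>F L in at_top. \<forall>\<theta>. \<bar>\<theta>\<bar> \<le> \<Theta> \<longrightarrow> L / 2 \<le> m L + \<theta> \<and> m L + \<theta> \<le> 2 * L \<and>
    \<bar>c * (L + K - (m L + \<theta>)) + t * ln (m L + \<theta>) - d / (m L + \<theta>)
       + c * \<theta> * (1 - t / (c * L) + t^2 * ln L / (c^2 * L^2))\<bar>
     \<le> (c * C1 + \<bar>t\<bar> * (4 * \<Theta>^2) + \<bar>t\<bar> * \<Theta> * C2 + 4 * \<bar>d\<bar> * \<Theta>) / L^2"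
    using C1 C2 eventually_ge_at_top[of "4 * \<Theta> + 4"]
  proof eventually_elim
    case (elim L)
    then have L: "L > 0" using \<Theta> by linarith
    have mL: "3 / 4 * L < m L" "m L < 3 / 2 * L" using elim L by (auto simp: field_simps)
    show ?case
    proof (intro allI impI conjI)
      fix \<theta> :: real assume \<theta>: "\<bar>\<theta>\<bar> \<le> \<Theta>"
      then have th: "\<bar>\<theta>\<bar> \<le> L / 4" using elim by linarith
      show W: "L / 2 \<le> m L + \<theta>" and "m L + \<theta> \<le> 2 * L" using th mL by linarith+
      have m0: "m L > 0" "m L + \<theta> > 0" using W L mL by linarith+
      define x where "x = \<theta> / m L"
      have ax: "\<bar>x\<bar> \<le> \<Theta> / (3 / 4 * L)"
        unfolding x_def abs_divide using \<theta> mL L \<Theta> by (intro frac_le) auto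
      have x12: "\<bar>x\<bar> \<le> 1 / 2"
      proof -
        have "\<bar>\<theta>\<bar> \<le> 1 / 2 * m L" using th mL by linarith
        then show ?thesis using m0 by (simp add: x_def abs_divide pos_divide_le_eq)
      qed
      have xsq: "2 * x^2 \<le> 4 * \<Theta>^2 / L^2"
      proof -
        have "x^2 \<le> (\<Theta> / (3 / 4 * L))^2" using power_mono[OF ax, of 2] by simp
        also have "\<dots> = 16 / 9 * (\<Theta>^2 / L^2)" by (simp add: power_divide power_mult_distrib)
        also have "\<dots> \<le> 2 * (\<Theta>^2 / L^2)" by (intro mult_right_mono) auto
        finally show ?thesis by simp
      qed
      have ln_eq: "ln (m L + \<theta>) = ln (m L) + ln (1 + x)"
      proof -
        have "m L + \<theta> = m L * (1 + x)" using m0 by (simp add: x_def distrib_left)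
        moreover have "1 + x > 0" using x12 by linarith
        ultimately show ?thesis using m0 by (simp add: ln_mult)
      qed
      have inv_eq: "d / (m L + \<theta>) = d / m L - d * \<theta> / (m L * (m L + \<theta>))"
      proof -
        have "d / W = d / M - d * (W - M) / (M * W)" if "M > 0" "W > 0" for M W
          using that by (simp add: field_simps)
        from this[OF m0] show ?thesis by simp
      qed
      have "c * \<theta> * (1 - t / (c * L) + t^2 * ln L / (c^2 * L^2)) =
          c * \<theta> - (c * a) * (t * \<theta> / L) + (c * a) * (t^2 * a * \<theta> * ln L / L^2)"
        by (simp add: a_def field_simps power2_eq_square)
      then have corr: "c * \<theta> * (1 - t / (c * L) + t^2 * ln L / (c^2 * L^2)) =
          c * \<theta> - t * \<theta> / L + t^2 * a * \<theta> * ln L / L^2" by (simp add: a)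
      have Feq: "c * F L = c * (L + K - m L) + t * ln (m L) - d / m L"
      proof -
        have "c * F L = c * (L + K - m L) + (c * a) * (t * ln (m L)) - (c * a) * (d / m L)"
          by (simp add: F_def algebra_simps)
        then show ?thesis by (simp add: a)
      qed
      have "c * (L + K - (m L + \<theta>)) + t * ln (m L + \<theta>) - d / (m L + \<theta>)
          + c * \<theta> * (1 - t / (c * L) + t^2 * ln L / (c^2 * L^2)) =
          c * F L + t * (ln (1 + x) - x) + t * \<theta> * G L + d * \<theta> / (m L * (m L + \<theta>))"
        unfolding ln_eq inv_eq corr Feq G_def x_def
        by (simp add: algebra_simps power2_eq_square)
      also have "\<bar>\<dots>\<bar> \<le> \<bar>c * F L\<bar> + \<bar>t * (ln (1 + x) - x)\<bar> + \<bar>t * \<theta> * G L\<bar> + \<bar>d * \<theta> / (m L * (m L + \<theta>))\<bar>"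
        by (intro order_trans[OF abs_triangle_ineq] add_right_mono) auto
      also have "\<bar>c * F L\<bar> \<le> c * (C1 / L^2)" unfolding abs_mult using c elim by (intro mult_mono) auto
      also have "\<bar>t * (ln (1 + x) - x)\<bar> \<le> \<bar>t\<bar> * (4 * \<Theta>^2 / L^2)"
        unfolding abs_mult using abs_ln_one_plus_x_minus_x_bound[OF x12] xsq by (intro mult_left_mono) auto
      also have "\<bar>t * \<theta> * G L\<bar> \<le> \<bar>t\<bar> * \<Theta> * (C2 / L^2)"
        unfolding abs_mult using elim \<theta> \<Theta> by (intro mult_mono) auto
      also have "\<bar>d * \<theta> / (m L * (m L + \<theta>))\<bar> \<le> \<bar>d\<bar> * \<Theta> / (L / 2 * (L / 2))"
        unfolding abs_mult abs_divide using \<theta> m0 mL W L by (intro frac_le mult_mono) auto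
      also have "\<bar>d\<bar> * \<Theta> / (L / 2 * (L / 2)) = 4 * \<bar>d\<bar> * \<Theta> / L^2" by (simp add: power2_eq_square)
      finally show "\<bar>c * (L + K - (m L + \<theta>)) + t * ln (m L + \<theta>) - d / (m L + \<theta>)
          + c * \<theta> * (1 - t / (c * L) + t^2 * ln L / (c^2 * L^2))\<bar>
          \<le> (c * C1 + \<bar>t\<bar> * (4 * \<Theta>^2) + \<bar>t\<bar> * \<Theta> * C2 + 4 * \<bar>d\<bar> * \<Theta>) / L^2"
        by (simp add: add_divide_distrib)
    qed
  qed
  then show ?thesis by blast
qed

section \<open>Lipschitz estimates for the exponential\<close>

lemma abs_exp_minus_one_le:
  fixes x :: real assumes "\<bar>x\<bar> \<le> 1" shows "\<bar>exp x - 1\<bar> \<le> 2 * \<bar>x\<bar>"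
proof (cases "x \<ge> 0")
  case True
  then have "exp x \<le> 1 + x + x^2" using assms by (intro exp_bound) auto
  moreover have "x^2 \<le> x" using True assms by (simp add: power2_eq_square mult_left_le_one_le)
  ultimately show ?thesis using True exp_ge_add_one_self[of x] by linarith
next
  case False
  then have "exp x < 1" by simp
  then show ?thesis using False exp_ge_add_one_self[of x] by linarith
qed

lemma abs_exp_diff_le:
  fixes x y :: real assumes "x \<le> 0" "y \<le> 0" shows "\<bar>exp x - exp y\<bar> \<le> \<bar>x - y\<bar>"
proof -
  have *: "exp b - exp a \<le> b - a" "0 \<le> exp b - exp a" if "a \<le> b" "b \<le> 0" for a b :: real
  proof -
    have "exp b - exp a = exp b * (1 - exp (a - b))" by (simp add: algebra_simps flip: exp_add)
    also have "\<dots> \<le> 1 * (1 - exp (a - b))" using that by (intro mult_right_mono) auto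
    also have "\<dots> \<le> b - a"
    proof -
      define z where "z = exp (a - b)"
      have "1 + (a - b) \<le> z" unfolding z_def by (rule exp_ge_add_one_self)
      then show ?thesis unfolding z_def[symmetric] by simp
    qed
    finally show "exp b - exp a \<le> b - a" .
  qed (use that in auto)
  show ?thesis using *[of x y] *[of y x] assms by linarith
qed

section \<open>The limit law\<close>

text \<open>The estimate for one fixed \<open>N\<close>, with explicit constants. Assumption
  \<open>h\<close> says that the logarithm of \<open>N * \<Lambda>\<close> is
  \<open>d / w - y\<close> up to \<open>O(1 / L^2)\<close>; the factor \<open>1 - d / w\<close> of
  \<open>first_prob\<close> then cancels \<open>exp (d / w)\<close> to the same order, leaving
  \<open>exp (- y)\<close>.\<close>

lemma avoid_prob_near:
  fixes p q c K d y B C1 K2 L :: real and w N T :: nat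
  assumes p: "0 < p" "p < 1" and q: "q = 1 - p" and c: "c = ln (1 / p)"
    and K: "c * K = real T * ln (q / p) - ln (fact T)"
    and N: "N > 0" and L: "c * L = ln (q * real N)" "L \<ge> 1" "L ^ 3 \<le> real N"
    and w: "w \<ge> 2" "L / 2 \<le> real w" "real w \<le> 2 * L"
    and d: "0 \<le> d" "d \<le> L / 2" and y: "\<bar>y\<bar> \<le> B" and C1: "C1 / L^2 \<le> 1" and K2: "0 \<le> K2"
    and T: "T \<le> w"
    and h: "\<bar>c * (L + K - real w) + real T * ln (real w) - d / real w + y\<bar> \<le> C1 / L^2"
    and b: "\<bar>first_prob q T w (2 * w - 1) - q ^ (T + 1) * p ^ (w - T) * (real w ^ T / fact T) * (1 - d / real w)\<bar>
              \<le> K2 * (q ^ (T + 1) * p ^ (w - T) * (real w ^ T / fact T)) / (real w)^2"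
  defines "D \<equiv> real (Suc T) * fact T / q ^ (T + 1) * exp (B + 2)"
  shows "\<bar>avoid_prob q T w N - exp (- exp (- y))\<bar> + few_prob q T w
           \<le> (4 * (K2 + d^2) * exp (B + 2) + 2 * exp B * C1 + 6 * (D + D^2) + 2 * D) / L^2"
proof -
  have q01: "0 < q" "q < 1" using p q by auto
  have lnp: "ln p = - c" using p by (simp add: c ln_div)
  define W where "W = real w"
  have W: "W > 0" using w by (simp add: W_def)
  define H where "H = c * (L + K - W) + real T * ln W - d / W + y"
  have H: "\<bar>H\<bar> \<le> C1 / L^2" using h by (simp add: H_def W_def)
  define \<Lambda> where "\<Lambda> = q ^ (T + 1) * p ^ (w - T) * (W ^ T / fact T)"
  let ?b = "first_prob q T w (2 * w - 1)" and ?a = "few_prob q T w"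
  have \<Lambda>0: "\<Lambda> > 0" using q01 p W by (simp add: \<Lambda>_def)
  have "ln (real N * \<Lambda>) = ln (real N) + (real (T + 1) * ln q + real (w - T) * ln p + (real T * ln W - ln (fact T)))"
    unfolding \<Lambda>_def using q01 p W N by (simp add: ln_mult ln_div ln_realpow distrib_right)
  also have "real (w - T) = W - real T" using T by (simp add: W_def)
  also have "ln (real N) + (real (T + 1) * ln q + (W - real T) * ln p + (real T * ln W - ln (fact T))) =
      c * (L + K - W) + real T * ln W"
  proof -
    have "c * L = ln q + ln (real N)" using L(1) q01 N by (simp add: ln_mult)
    moreover have "c * K = real T * (ln q + c) - ln (fact T)"
      using K q01 p by (simp add: ln_div lnp)
    ultimately show ?thesis by (simp add: lnp algebra_simps)
  qed
  also have "\<dots> = H + d / W - y" by (simp add: H_def)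
  finally have N\<Lambda>: "real N * \<Lambda> = exp (H + d / W - y)"
    using N \<Lambda>0 by (metis exp_ln mult_pos_pos of_nat_0_less_iff)
  have dW: "0 \<le> d / W" "d / W \<le> 1" using d w W by (auto simp: W_def)
  have N\<Lambda>0: "0 \<le> real N * \<Lambda>" using \<Lambda>0 by simp
  \<comment> \<open>In the exponent of \<open>N\<Lambda>\<close>, \<open>H\<close> and
    \<open>d / W\<close> are at most 1 each and \<open>- y\<close> is at most
    \<open>B\<close>.\<close>
  define M where "M = exp (B + 2)"
  have M: "real N * \<Lambda> \<le> M" unfolding N\<Lambda> M_def using H C1 dW y by simp
  have sq: "1 / W^2 \<le> 4 / L^2"
  proof -
    have "(L / 2)^2 \<le> W^2" using w L by (intro power_mono) (auto simp: W_def)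
    moreover have "0 < (L / 2)^2" using L by simp
    ultimately have "1 / W^2 \<le> 1 / (L / 2)^2" using W by (intro divide_left_mono mult_pos_pos) auto
    then show ?thesis by (simp add: power_divide)
  qed
  have 1: "\<bar>real N * ?b - real N * \<Lambda> * (1 - d / W)\<bar> \<le> K2 * M * (4 / L^2)"
  proof -
    have "\<bar>real N * ?b - real N * \<Lambda> * (1 - d / W)\<bar> = real N * \<bar>?b - \<Lambda> * (1 - d / W)\<bar>"
    proof -
      have "real N * ?b - real N * \<Lambda> * (1 - d / W) = real N * (?b - \<Lambda> * (1 - d / W))"
        by (simp only: right_diff_distrib mult.assoc)
      then show ?thesis by (simp add: abs_mult)
    qed
    also have "\<dots> \<le> real N * (K2 * \<Lambda> / W^2)"
      using b by (intro mult_left_mono) (simp_all add: \<Lambda>_def W_def)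
    also have "\<dots> = K2 * (real N * \<Lambda>) * (1 / W^2)" by simp
    also have "\<dots> \<le> K2 * M * (4 / L^2)"
      using sq M K2 N\<Lambda>0 by (intro mult_mono) (auto simp: M_def)
    finally show ?thesis .
  qed
  have 2: "\<bar>real N * \<Lambda> * exp (- (d / W)) - real N * \<Lambda> * (1 - d / W)\<bar> \<le> M * (d^2 * (4 / L^2))"
  proof -
    have "\<bar>real N * \<Lambda> * exp (- (d / W)) - real N * \<Lambda> * (1 - d / W)\<bar> =
        real N * \<Lambda> * \<bar>exp (- (d / W)) - (1 - d / W)\<bar>"
    proof -
      have "real N * \<Lambda> * exp (- (d / W)) - real N * \<Lambda> * (1 - d / W) =
          real N * \<Lambda> * (exp (- (d / W)) - (1 - d / W))"
        by (simp only: right_diff_distrib)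
      then show ?thesis using \<Lambda>0 by (simp add: abs_mult)
    qed
    also have "\<dots> \<le> M * (d / W)^2"
      using M \<Lambda>0 abs_exp_minus_one_minus[OF dW(1)] by (intro mult_mono) (auto simp: M_def)
    also have "(d / W)^2 = d^2 * (1 / W^2)" by (simp add: power_divide)
    also have "M * \<dots> \<le> M * (d^2 * (4 / L^2))"
      using sq by (intro mult_left_mono) (auto simp: M_def)
    finally show ?thesis .
  qed
  have 3: "\<bar>real N * \<Lambda> * exp (- (d / W)) - exp (- y)\<bar> \<le> exp B * (2 * (C1 / L^2))"
  proof -
    have E: "real N * \<Lambda> * exp (- (d / W)) = exp (- y) * exp H"
      unfolding N\<Lambda> by (simp flip: exp_add)
    have "\<bar>real N * \<Lambda> * exp (- (d / W)) - exp (- y)\<bar> = exp (- y) * \<bar>exp H - 1\<bar>"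
    proof -
      have "real N * \<Lambda> * exp (- (d / W)) - exp (- y) = exp (- y) * (exp H - 1)"
        unfolding E by (simp add: right_diff_distrib)
      then show ?thesis by (simp add: abs_mult)
    qed
    also have "\<dots> \<le> exp B * (2 * (C1 / L^2))"
      using y H C1 abs_exp_minus_one_le[of H] by (intro mult_mono) auto
    finally show ?thesis .
  qed
  have N\<beta>: "\<bar>real N * ?b - exp (- y)\<bar> \<le> (4 * (K2 + d^2) * M + 2 * exp B * C1) / L^2"
  proof -
    have "\<bar>real N * ?b - exp (- y)\<bar> \<le> K2 * M * (4 / L^2) + M * (d^2 * (4 / L^2)) + exp B * (2 * (C1 / L^2))"
    proof -
      have "\<bar>x - u\<bar> \<le> e1 + e2 + e3" if "\<bar>x - v\<bar> \<le> e1" "\<bar>z - v\<bar> \<le> e2" "\<bar>z - u\<bar> \<le> e3"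
        for x u v z e1 e2 e3 :: real using that by linarith
      from this[OF 1 2 3] show ?thesis .
    qed
    also have "\<dots> = (4 * (K2 + d^2) * M + 2 * exp B * C1) / L^2"
      by (simp add: add_divide_distrib algebra_simps)
    finally show ?thesis .
  qed
  have b0: "0 \<le> ?b" by (rule first_prob_nonneg)
  have "\<bar>exp (- (real N * ?b)) - exp (- exp (- y))\<bar> \<le> \<bar>- (real N * ?b) - - exp (- y)\<bar>"
    using b0 by (intro abs_exp_diff_le) auto
  also have "\<dots> = \<bar>real N * ?b - exp (- y)\<bar>" by linarith
  finally have e: "\<bar>exp (- (real N * ?b)) - exp (- exp (- y))\<bar> \<le> (4 * (K2 + d^2) * M + 2 * exp B * C1) / L^2"
    using N\<beta> by (rule order_trans)
  have a0: "0 \<le> ?a" by (rule few_prob_nonneg)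
  have aD: "?a \<le> D / real N"
  proof -
    have "?a \<le> real (Suc T) * real w ^ T * (1 - q) ^ (w - T)"
      using few_prob_le[of q w T] q01 w T by auto
    also have "\<dots> = real (Suc T) * fact T / q ^ (T + 1) * \<Lambda>"
      using q01 by (simp add: \<Lambda>_def W_def q)
    also have "\<dots> \<le> real (Suc T) * fact T / q ^ (T + 1) * (M / real N)"
      using M N q01 by (intro mult_left_mono) (auto simp: field_simps)
    finally show ?thesis by (simp add: D_def M_def)
  qed
  have D0: "0 \<le> D" using q01 by (simp add: D_def)
  \<comment> \<open>Here \<open>L ^ 3 \<le> real N\<close> turns the window errors, of order
    \<open>L / N\<close>, into \<open>1 / L^2\<close>.\<close>
  have LN: "L / real N \<le> 1 / L^2" "1 / real N \<le> 1 / L^2"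
  proof -
    show 1: "L / real N \<le> 1 / L^2"
      using L N by (simp add: field_simps power2_eq_square power3_eq_cube)
    have "1 / real N \<le> L / real N" using L by (intro divide_right_mono) auto
    with 1 show "1 / real N \<le> 1 / L^2" by linarith
  qed
  have "\<bar>avoid_prob q T w N - exp (- (real N * ?b))\<bar> \<le> 3 * W * ?a + 3 * real N * W * ?a^2"
    using avoid_prob_approx_exp[of w q T N] w by (simp add: W_def)
  also have "\<dots> \<le> 3 * (2 * L) * (D / real N) + 3 * real N * (2 * L) * (D / real N)^2"
    using aD a0 w D0 L by (intro add_mono mult_mono power_mono) (auto simp: W_def)
  also have "\<dots> = 6 * (D + D^2) * (L / real N)"
    using N by (simp add: field_simps power2_eq_square)
  also have "\<dots> \<le> 6 * (D + D^2) * (1 / L^2)"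
    using LN D0 by (intro mult_left_mono) auto
  finally have f: "\<bar>avoid_prob q T w N - exp (- (real N * ?b))\<bar> \<le> 6 * (D + D^2) / L^2" by simp
  have "?a \<le> D * (1 / real N)" using aD by simp
  also have "\<dots> \<le> D * (1 / L^2)" using LN D0 by (intro mult_left_mono) auto
  also have "\<dots> \<le> 2 * D / L^2" using D0 by (simp add: divide_right_mono)
  finally have a: "?a \<le> 2 * D / L^2" .
  have "\<bar>avoid_prob q T w N - exp (- exp (- y))\<bar> + ?a \<le>
      6 * (D + D^2) / L^2 + (4 * (K2 + d^2) * M + 2 * exp B * C1) / L^2 + 2 * D / L^2"
  proof -
    have "\<bar>x - u\<bar> + r \<le> e1 + e2 + e3" if "\<bar>x - v\<bar> \<le> e1" "\<bar>v - u\<bar> \<le> e2" "r \<le> e3"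
      for x u v r e1 e2 e3 :: real using that by linarith
    from this[OF f e a] show ?thesis .
  qed
  also have "\<dots> = (4 * (K2 + d^2) * M + 2 * exp B * C1 + 6 * (D + D^2) + 2 * D) / L^2"
    by (simp add: add_divide_distrib)
  finally show ?thesis by (simp add: M_def)
qed

section \<open>The centering and the main term in natural logarithms\<close>

lemma run_centering_eq:
  assumes "0 < p" "p < 1"
  shows "run_centering p T N = centering (1 / ln (1 / p)) (real T)
      ((real T * ln ((1 - p) / p) - ln (fact T)) / ln (1 / p))
      (real T / (2 * (1 - p) / (2 + real T * (1 - p) - (1 - p)))) (log (1 / p) ((1 - p) * real N))"
proof -
  define a where "a = 1 / ln (1 / p)"
  define L where "L = log (1 / p) ((1 - p) * real N)"
  define q0 where "q0 = 2 * (1 - p) / (2 + real T * (1 - p) - (1 - p))"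
  define K where "K = (real T * ln ((1 - p) / p) - ln (fact T)) / ln (1 / p)"
  have ll: "log (1 / p) x = a * ln x" for x by (simp add: log_def a_def)
  have K': "real T * (a * ln ((1 - p) / p)) - a * ln (fact T) = K"
    by (simp add: K_def a_def diff_divide_distrib)
  have c: "x / (ln (1 / p) * z) = x * a / z" "x / (2 * ln (1 / p)) = x * a / 2"
    "x / (ln (1 / p) * z)^2 = x * a^2 / z^2" for x z by (simp_all add: a_def power_divide power_mult_distrib)
  have "run_centering p T N = L + real T * (a * ln L) + (real T)^2 * (a * ln L * a / L) - real T * a / (q0 * L)
      - (real T)^3 * a / 2 * (a * ln L / L)^2 + (real T)^2 * (a * ln L * a / (q0 * L^2)) +
      (real T)^3 * (a * ln L * a^2 / L^2) + K * (1 + real T * a / L - (real T)^2 * (a * ln L * a / L^2))"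
    unfolding run_centering_def Let_def q0_def[symmetric] L_def[symmetric]
    unfolding ll c K' mult.assoc[of "ln (1 / p)"] by simp
  also have "\<dots> = centering a (real T) K (real T / q0) L"
    unfolding centering_def
    by (simp add: add_divide_distrib diff_divide_distrib power_divide power_mult_distrib algebra_simps
        power2_eq_square power3_eq_cube)
  finally show ?thesis by (simp add: a_def L_def q0_def K_def)
qed

lemma run_main_term_eq:
  fixes p :: real and T N :: nat and k :: int
  assumes "0 < p" "p < 1"
  defines "c \<equiv> ln (1 / p)" and "L \<equiv> log (1 / p) ((1 - p) * real N)"
  shows "run_main_term p T k N = exp (- exp (- (c * (real_of_int k - frac (run_centering p T N)) *
     (1 - real T / (c * L) + (real T)^2 * ln L / (c^2 * L^2)))))"
proof -
  have c: "ln p = - c" "c > 0" using assms by (auto simp: c_def ln_div)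
  have "run_main_term p T k N = exp (- exp ((real_of_int k - frac (run_centering p T N)) *
     (1 - real T / (c * L) + (real T)^2 * (log (1 / p) L / (c * L^2))) * ln p))"
    using assms(1) by (simp add: run_main_term_def Let_def L_def c_def powr_def mult.commute)
  also have "log (1 / p) L / (c * L^2) = ln L / (c^2 * L^2)"
    by (simp add: log_def c_def power2_eq_square)
  finally show ?thesis by (simp add: c mult_ac)
qed

text \<open>For \<theta> equal to \<open>k\<close> minus the fractional part of the centering,
  centering plus \<theta> is exactly the integer \<open>w N\<close>, and \<theta> is bounded. The
  lower bound \<open>exp (- g)\<close> for the main term is what later turns absolute into relative
  error.\<close>

lemma avoid_prob_asymp:
  fixes p :: real and T :: nat and k :: int
  assumes T: "T = 1 \<or> T = 2" and p: "0 < p" "p < 1"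
  defines "w \<equiv> \<lambda>N. nat (\<lfloor>run_centering p T N\<rfloor> + k)"
  shows "\<exists>C g. \<forall>\<^sub>F N in sequentially. 1 \<le> w N \<and> w N \<le> N \<and> exp (- g) \<le> run_main_term p T k N \<and>
     \<bar>avoid_prob (1 - p) T (w N) N - run_main_term p T k N\<bar> + few_prob (1 - p) T (w N)
       \<le> C / (log (1 / p) ((1 - p) * real N))^2"
proof -
  define q where "q = 1 - p"
  define c where "c = ln (1 / p)"
  define d where "d = real T / (2 * q / (2 + real T * q - q))"
  define K where "K = (real T * ln (q / p) - ln (fact T)) / c"
  define L where "L N = log (1 / p) (q * real N)" for N
  define m where "m = centering (1 / c) (real T) K d"
  define \<Theta> where "\<Theta> = \<bar>real_of_int k\<bar> + 1"
  have q01: "0 < q" "q < 1" using p by (auto simp: q_def)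
  have c0: "c > 0" using p by (simp add: c_def)
  have "0 < 2 + real T * q - q" using q01 by (intro add_pos_nonneg[of "2 - q" "real T * q", simplified add_diff_eq diff_add_eq]) auto
  then have d0: "d \<ge> 0" using q01 by (simp add: d_def)
  have rc: "run_centering p T N = m (L N)" for N
    unfolding run_centering_eq[OF p] m_def c_def K_def d_def q_def L_def ..
  obtain C1 where C1: "\<forall>\<^sub>F L in at_top. \<forall>\<theta>. \<bar>\<theta>\<bar> \<le> \<Theta> \<longrightarrow> L / 2 \<le> m L + \<theta> \<and> m L + \<theta> \<le> 2 * L \<and>
    \<bar>c * (L + K - (m L + \<theta>)) + real T * ln (m L + \<theta>) - d / (m L + \<theta>)
       + c * \<theta> * (1 - real T / (c * L) + (real T)^2 * ln L / (c^2 * L^2))\<bar> \<le> C1 / L^2"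
    using centering_asymp_shift[OF c0, of \<Theta> "real T" K d] unfolding m_def \<Theta>_def by auto
  obtain K2' where K2': "\<forall>w\<ge>2. \<bar>first_prob q T w (2 * w - 1) - q ^ (T + 1) * p ^ (w - T) * (real w ^ T / fact T) * (1 - d / real w)\<bar>
              \<le> K2' * (q ^ (T + 1) * p ^ (w - T) * (real w ^ T / fact T)) / (real w)^2"
    using first_prob_asymp[OF T p] unfolding q_def d_def by blast
  define K2 where "K2 = \<bar>K2'\<bar>"
  have K2: "\<bar>first_prob q T w (2 * w - 1) - q ^ (T + 1) * p ^ (w - T) * (real w ^ T / fact T) * (1 - d / real w)\<bar>
              \<le> K2 * (q ^ (T + 1) * p ^ (w - T) * (real w ^ T / fact T)) / (real w)^2" if "w \<ge> 2" for w
  proof -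
    have "K2' * (q ^ (T + 1) * p ^ (w - T) * (real w ^ T / fact T)) / (real w)^2 \<le>
        K2 * (q ^ (T + 1) * p ^ (w - T) * (real w ^ T / fact T)) / (real w)^2"
      using q01 p by (intro divide_right_mono mult_right_mono) (auto simp: K2_def)
    with K2' that show ?thesis by (meson order_trans)
  qed
  \<comment> \<open>The bound for \<open>y = c * \<theta> * Y\<close>, with the correction factor
    \<open>Y\<close> eventually below 2 in absolute value.\<close>
  define B where "B = 2 * c * \<Theta>"
  have "((\<lambda>L. 1 - real T / (c * L) + (real T)^2 * ln L / (c^2 * L^2)) \<longlongrightarrow> 1) at_top"
    using c0 by real_asymp
  then have Y: "\<forall>\<^sub>F L in at_top. \<bar>1 - real T / (c * L) + (real T)^2 * ln L / (c^2 * L^2)\<bar> < 2"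
    by (intro order_tendstoD(2)[where y = 1] tendsto_rabs) (auto dest: tendsto_rabs)
  have "\<forall>\<^sub>F L in at_top. L ^ 3 \<le> exp (c * L) / q" using c0 q01 by real_asymp
  moreover have "\<forall>\<^sub>F L in at_top. C1 / L^2 \<le> 1" by real_asymp
  ultimately have ev: "\<forall>\<^sub>F L in at_top. L ^ 3 \<le> exp (c * L) / q \<and> C1 / L^2 \<le> 1 \<and> L \<ge> 4 \<and> L \<ge> 2 * d \<and>
      \<bar>1 - real T / (c * L) + (real T)^2 * ln L / (c^2 * L^2)\<bar> < 2 \<and>
      (\<forall>\<theta>. \<bar>\<theta>\<bar> \<le> \<Theta> \<longrightarrow> L / 2 \<le> m L + \<theta> \<and> m L + \<theta> \<le> 2 * L \<and>
        \<bar>c * (L + K - (m L + \<theta>)) + real T * ln (m L + \<theta>) - d / (m L + \<theta>)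
       + c * \<theta> * (1 - real T / (c * L) + (real T)^2 * ln L / (c^2 * L^2))\<bar> \<le> C1 / L^2)"
    using Y C1 eventually_ge_at_top[of 4] eventually_ge_at_top[of "2 * d"] by eventually_elim simp
  have "filterlim (\<lambda>N. ln (q * real N) / c) at_top sequentially" using c0 q01 by real_asymp
  then have "filterlim L at_top sequentially" by (simp add: L_def[abs_def] log_def c_def)
  with ev have evN: "\<forall>\<^sub>F N in sequentially. L N ^ 3 \<le> exp (c * L N) / q \<and> C1 / (L N)^2 \<le> 1 \<and> L N \<ge> 4 \<and> L N \<ge> 2 * d \<and>
      \<bar>1 - real T / (c * L N) + (real T)^2 * ln (L N) / (c^2 * (L N)^2)\<bar> < 2 \<and>
      (\<forall>\<theta>. \<bar>\<theta>\<bar> \<le> \<Theta> \<longrightarrow> L N / 2 \<le> m (L N) + \<theta> \<and> m (L N) + \<theta> \<le> 2 * L N \<and>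
        \<bar>c * (L N + K - (m (L N) + \<theta>)) + real T * ln (m (L N) + \<theta>) - d / (m (L N) + \<theta>)
       + c * \<theta> * (1 - real T / (c * L N) + (real T)^2 * ln (L N) / (c^2 * (L N)^2))\<bar> \<le> C1 / (L N)^2)"
    by (rule eventually_compose_filterlim)
  define D where "D = real (Suc T) * fact T / q ^ (T + 1) * exp (B + 2)"
  define C where "C = 4 * (K2 + d^2) * exp (B + 2) + 2 * exp B * C1 + 6 * (D + D^2) + 2 * D"
  have "\<forall>\<^sub>F N in sequentially. 1 \<le> w N \<and> w N \<le> N \<and> exp (- exp B) \<le> run_main_term p T k N \<and>
     \<bar>avoid_prob q T (w N) N - run_main_term p T k N\<bar> + few_prob q T (w N) \<le> C / (L N)^2"
    using evN eventually_gt_at_top[of 0]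
  proof eventually_elim
    case (elim N)
    define l where "l = L N"
    define \<theta> where "\<theta> = real_of_int k - frac (m l)"
    define Y where "Y = 1 - real T / (c * l) + (real T)^2 * ln l / (c^2 * l^2)"
    define y where "y = c * \<theta> * Y"
    have l: "l ^ 3 \<le> exp (c * l) / q" "C1 / l^2 \<le> 1" "l \<ge> 4" "l \<ge> 2 * d" "\<bar>Y\<bar> < 2"
      using elim by (auto simp: l_def Y_def)
    have th: "\<bar>\<theta>\<bar> \<le> \<Theta>" using frac_ge_0[of "m l"] frac_lt_1[of "m l"] unfolding \<theta>_def \<Theta>_def by linarith
    with elim have m: "l / 2 \<le> m l + \<theta>" "m l + \<theta> \<le> 2 * l"
      "\<bar>c * (l + K - (m l + \<theta>)) + real T * ln (m l + \<theta>) - d / (m l + \<theta>) + y\<bar> \<le> C1 / l^2"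
      by (auto simp: l_def y_def Y_def)
    have "m l + \<theta> = real_of_int (\<lfloor>m l\<rfloor> + k)" by (simp add: \<theta>_def frac_def)
    moreover have "m l + \<theta> > 0" using m l by linarith
    ultimately have w: "real (w N) = m l + \<theta>" by (simp add: w_def rc l_def)
    have cl: "c * l = ln (q * real N)" using c0 by (simp add: l_def L_def log_def c_def)
    have N: "real N = exp (c * l) / q" using q01 elim by (simp add: cl)
    \<comment> \<open>This leads to \<open>w N \<le> N\<close>: the width is at most
      \<open>2 * l\<close>, hence below \<open>l ^ 3\<close>, which is at most
      \<open>N\<close>.\<close>
    have "4 * l \<le> l ^ 2 * l"
    proof (rule mult_right_mono)
      have "4 * 4 \<le> l * l" using l by (intro mult_mono) auto
      then show "4 \<le> l ^ 2" by (simp add: power2_eq_square)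
    qed (use l in auto)
    then have "4 * l \<le> l ^ 3" by (simp add: power3_eq_cube power2_eq_square)
    then have "real (w N) \<le> real N" using w m l N by linarith
    then have wN: "w N \<le> N" by simp
    have "real (w N) \<ge> 2" using w m l by linarith
    then have w2: "w N \<ge> 2" by simp
    have yB: "\<bar>y\<bar> \<le> B"
    proof -
      have "\<bar>y\<bar> = c * \<bar>\<theta>\<bar> * \<bar>Y\<bar>" using c0 by (simp add: y_def abs_mult)
      also have "\<dots> \<le> c * \<Theta> * 2" using c0 th l(5) by (intro mult_mono) (auto simp: \<Theta>_def)
      finally show ?thesis by (simp add: B_def)
    qed
    have main: "run_main_term p T k N = exp (- exp (- y))"
      unfolding run_main_term_eq[OF p] rc by (simp add: y_def Y_def \<theta>_def l_def L_def q_def c_def)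
    have "\<bar>avoid_prob q T (w N) N - exp (- exp (- y))\<bar> + few_prob q T (w N) \<le> C / l^2"
    proof -
      have "c * K = real T * ln (q / p) - ln (fact T)" using c0 by (simp add: K_def)
      moreover have "0 < N" "1 \<le> l" "l ^ 3 \<le> real N" "l / 2 \<le> real (w N)" "real (w N) \<le> 2 * l"
        "d \<le> l / 2" "0 \<le> K2" "T \<le> w N"
        using elim l m w N w2 T by (auto simp: K2_def)
      moreover have "\<bar>c * (l + K - real (w N)) + real T * ln (real (w N)) - d / real (w N) + y\<bar> \<le> C1 / l^2"
        using m(3) unfolding w .
      ultimately show ?thesis
        unfolding C_def D_def
        using avoid_prob_near[OF p q_def c_def _ _ cl _ _ w2 _ _ d0 _ yB l(2) _ _ _ K2[OF w2]] by blast
    qed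
    moreover have "exp (- exp B) \<le> exp (- exp (- y))" using yB by auto
    ultimately show ?case using wN w2 main by (simp add: l_def)
  qed
  then show ?thesis unfolding q_def[symmetric] L_def by blast
qed

lemma log_scaled_bigo:
  fixes q b :: real assumes "0 < q" "1 < b"
  shows "(\<lambda>N. 1 / (log b (q * real N))^2) \<in> O(\<lambda>N. 1 / (log b (real N))^2)"
  using assms unfolding log_def by real_asymp

theorem theorem2p2:
  fixes p :: real and T :: nat and k :: int
    and M :: "nat \<Rightarrow> 'a measure"
    and X :: "nat \<Rightarrow> nat \<Rightarrow> 'a \<Rightarrow> real"
  assumes "T = 1 \<or> T = 2"
    and "0 < p" and "p < 1"
    and "\<And>N. prob_space (M N)"
    and "\<And>N. prob_space.indep_vars (M N) (\<lambda>_. borel) (X N) {1..N}"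
    and "\<And>N i. i \<in> {1..N} \<Longrightarrow> measure (M N) {\<omega> \<in> space (M N). X N i \<omega> = 1} = p"
    and "\<And>N i. i \<in> {1..N} \<Longrightarrow> measure (M N) {\<omega> \<in> space (M N). X N i \<omega> = 0} = 1 - p"
  shows "\<exists>e :: nat \<Rightarrow> real. e \<in> O(\<lambda>N. 1 / (log (1 / p) (real N))^2) \<and>
    (\<forall>\<^sub>F N in sequentially.
       measure (M N) {\<omega> \<in> space (M N).
         int (longest_run T N (\<lambda>i. X N i \<omega>)) - \<lfloor>run_centering p T N\<rfloor> < k}
       = run_main_term p T k N * (1 + e N))"
proof -
  define w where "w N = nat (\<lfloor>run_centering p T N\<rfloor> + k)" for N
  define P where "P N = measure (M N) {\<omega> \<in> space (M N).
         int (longest_run T N (\<lambda>i. X N i \<omega>)) - \<lfloor>run_centering p T N\<rfloor> < k}" for N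
  define e where "e N = P N / run_main_term p T k N - 1" for N
  have pos: "run_main_term p T k N > 0" for N by (simp add: run_main_term_def Let_def)
  obtain C g where ev: "\<forall>\<^sub>F N in sequentially. 1 \<le> w N \<and> w N \<le> N \<and> exp (- g) \<le> run_main_term p T k N \<and>
     \<bar>avoid_prob (1 - p) T (w N) N - run_main_term p T k N\<bar> + few_prob (1 - p) T (w N)
       \<le> C / (log (1 / p) ((1 - p) * real N))^2"
    using avoid_prob_asymp[OF assms(1-3), of k] unfolding w_def by blast
  have "e \<in> O(\<lambda>N. 1 / (log (1 / p) ((1 - p) * real N))^2)"
  proof (rule bigoI)
    show "\<forall>\<^sub>F N in sequentially. norm (e N) \<le> exp g * C * norm (1 / (log (1 / p) ((1 - p) * real N))^2)"
      using ev
    proof eventually_elim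
      case (elim N)
      interpret prob_space "M N" by (rule assms(4))
      let ?r = "run_main_term p T k N" and ?L = "log (1 / p) ((1 - p) * real N)"
      \<comment> \<open>Truncation by \<open>nat\<close> is harmless: if the floor plus
        \<open>k\<close> is not positive, neither inequality can hold.\<close>
      have "P N = prob {\<omega> \<in> space (M N). longest_run T N (\<lambda>i. X N i \<omega>) < w N}"
        unfolding P_def w_def by (intro arg_cong[of _ _ prob] Collect_cong conj_cong refl) linarith
      also have "\<bar>\<dots> - avoid_prob (1 - p) T (w N) N\<bar> \<le> few_prob (1 - p) T (w N)"
        using assms(2,3) elim by (intro prob_longest_run_approx assms(5-7)) auto
      finally have "\<bar>P N - avoid_prob (1 - p) T (w N) N\<bar> \<le> few_prob (1 - p) T (w N)" .
      with elim have "\<bar>P N - ?r\<bar> \<le> C / ?L^2" by linarith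
      \<comment> \<open>Division by the main term costs at most the factor
        \<open>exp g\<close>.\<close>
      have "\<bar>e N\<bar> = \<bar>P N - ?r\<bar> / ?r"
        using pos[of N] by (simp add: e_def abs_divide[symmetric] diff_divide_distrib abs_if)
      moreover have "\<bar>P N - ?r\<bar> / ?r \<le> C / ?L^2 / exp (- g)"
        using \<open>\<bar>P N - ?r\<bar> \<le> C / ?L^2\<close> elim
        by (intro frac_le order_trans[OF abs_ge_zero[of "P N - ?r"]]) auto
      ultimately have "\<bar>e N\<bar> \<le> C / ?L^2 / exp (- g)" by simp
      then show ?case by (simp add: exp_minus field_simps)
    qed
  qed
  also have "(\<lambda>N. 1 / (log (1 / p) ((1 - p) * real N))^2) \<in> O(\<lambda>N. 1 / (log (1 / p) (real N))^2)"
    using assms(2,3) by (intro log_scaled_bigo) auto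
  finally have "e \<in> O(\<lambda>N. 1 / (log (1 / p) (real N))^2)" .
  moreover have "P N = run_main_term p T k N * (1 + e N)" for N
    using pos[of N] by (simp add: e_def)
  ultimately show ?thesis unfolding P_def by (intro exI[of _ e]) auto
qed

end
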